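(* Let $g>0$ and $c\in\mathbb{R}$. The equation $$2g\,\Im W=c^2\,\frac{W_\alpha+\bar W_\alpha+|W_\alpha|^2}{|1+W_\alpha|^2}\qquad\text{on }\mathbb{R}$$ has no nontrivial holomorphic solutions $W$ with regularity $$W_\alpha\in\dot B^{1/2}_{2,1}(\mathbb{R}),\qquad |1+W_\alpha|\ge\delta>0 \ \text{ for some constant }\delta .$$ That is, every holomorphic solution $W$ with this regularity is constant (and then real).
   Context: $W=W(\alpha)$ is a complex valued function on $\mathbb{R}$, $W_\alpha=\partial_\alpha W$. Besov space. Let $1=\sum_{k\in\mathbb{Z}}P_k$ be a standard dyadic Littlewood-Paley decomposition on $\mathbb{R}$, where $P_k$ selects frequencies $\approx 2^k$. Then $\|u\|_{\dot B^{1/2}_{2,1}}=\sum_{k\in\mathbb{Z}}2^{k/2}\|P_ku\|_{L^2}$. Elements of $\dot B^{1/2}_{2,1}$ are realized as functions $u=\sum_k P_ku$ (uniformly convergent series), so that they are bounded and continuous and vanish at infinity. "Holomorphic" means that $W$ admits a Lipschitz extension to the closed lower half plane which is holomorphic in $\mathbb{H}=\{\alpha-i\beta:\beta>0\}$; at the level of $W_\alpha$ this says that the Fourier transform of $W_\alpha$ is supported in $(-\infty,0]$. Moreover $Z=\alpha+W$ is (the boundary value of) a conformal map on $\mathbb{H}$; of this, only the fact that the holomorphic extension of $1+W_\alpha$ has no zeros in $\mathbb{H}$ is assumed. No assumption that the curve $Z(\mathbb{R})$ is a graph is made. Trivial solutions are the constant ones, $W_\alpha\equiv0$ (which reduce to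 $W\equiv 0$ under the normalization $W\to0$ at infinity). *)

theory Defs
  imports "HOL-Complex_Analysis.Complex_Analysis"
begin

text \<open>
  A dyadic multiplier is the symbol of \<open>P\<^sub>0\<close>: smooth, supported in an annulus, and such that its
  dyadic dilates, the symbols of \<open>P\<^sub>k\<close>, sum to 1 off the origin.
\<close>

definition dyadic_multiplier :: "(real \<Rightarrow> real) \<Rightarrow> bool" where
  "dyadic_multiplier \<phi> \<longleftrightarrow>
     (\<forall>n. (deriv ^^ n) \<phi> differentiable_on UNIV) \<and>
     (\<exists>a b. 0 < a \<and> a < b \<and> (\<forall>\<xi>. \<phi> \<xi> \<noteq> 0 \<longrightarrow> a \<le> \<bar>\<xi>\<bar> \<and> \<bar>\<xi>\<bar> \<le> b)) \<and>
     (\<forall>\<xi>. \<xi> \<noteq> 0 \<longrightarrow> ((\<lambda>k::int. \<phi> (\<xi> / 2 powi k)) has_sum 1) UNIV)"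

text \<open>
  The projection \<open>P\<^sub>k\<close>, with symbol \<open>\<phi> (\<xi> / 2\<^sup>k)\<close>, acts by convolution with the inverse Fourier
  transform of its symbol. This kernel is a Schwartz function, so the convolution integral converges
  absolutely for bounded continuous \<open>u\<close>, the only functions to which it is applied below.
\<close>

definition LP_kernel :: "(real \<Rightarrow> real) \<Rightarrow> int \<Rightarrow> real \<Rightarrow> complex" where
  "LP_kernel \<phi> k x =
     (LINT \<xi>|lborel. complex_of_real (\<phi> (\<xi> / 2 powi k)) * cis (x * \<xi>)) / (2 * complex_of_real pi)"

definition LP_proj :: "(real \<Rightarrow> real) \<Rightarrow> int \<Rightarrow> (real \<Rightarrow> complex) \<Rightarrow> real \<Rightarrow> complex" where
  "LP_proj \<phi> k u x = (LINT y|lborel. LP_kernel \<phi> k (x - y) * u y)"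

definition square_integrable :: "(real \<Rightarrow> complex) \<Rightarrow> bool" where
  "square_integrable f \<longleftrightarrow>
     f \<in> borel_measurable lborel \<and> integrable lborel (\<lambda>x. (cmod (f x))\<^sup>2)"

definition L2_norm :: "(real \<Rightarrow> complex) \<Rightarrow> real" where
  "L2_norm f = sqrt (LINT x|lborel. (cmod (f x))\<^sup>2)"

text \<open>
  The homogeneous Besov space \<open>B\<^sup>1\<^sup>/\<^sup>2\<close> with indices \<open>(2,1)\<close>, its elements being realized as the sums
  of their uniformly convergent Littlewood--Paley series (which rules out nonzero additive constants).
  Boundedness and continuity hold for every such sum; they are listed because they give meaning
  to the convolutions \<open>P\<^sub>k u\<close>.
\<close>

definition besov_half_2_1 :: "(real \<Rightarrow> real) \<Rightarrow> (real \<Rightarrow> complex) set" where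
  "besov_half_2_1 \<phi> = {u.
     continuous_on UNIV u \<and> bounded (range u) \<and>
     (\<forall>k. square_integrable (LP_proj \<phi> k u)) \<and>
     (\<lambda>k::int. 2 powr (of_int k / 2) * L2_norm (LP_proj \<phi> k u)) summable_on UNIV \<and>
     uniform_limit UNIV (\<lambda>K x. \<Sum>k\<in>K. LP_proj \<phi> k u x) u (finite_subsets_at_top UNIV)}"

definition holomorphic_extension :: "(real \<Rightarrow> complex) \<Rightarrow> (complex \<Rightarrow> complex) \<Rightarrow> bool" where
  "holomorphic_extension W F \<longleftrightarrow>
     (\<exists>L. L-lipschitz_on {z. Im z \<le> 0} F) \<and>
     F holomorphic_on {z. Im z < 0} \<and>
     (\<forall>\<alpha>. F (complex_of_real \<alpha>) = W \<alpha>)"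

end

theory Submission
  imports Defs "HOL-Probability.Sinc_Integral"
begin

text \<open>
  Write \<open>H\<close> for the lower half plane, \<open>G = F'\<close>, \<open>y = Im W\<close>, and let \<open>c \<noteq> 0\<close>, \<open>\<mu> = 2 g / c\<^sup>2\<close>. The
  equation is Bernoulli's law \<open>1 / |1 + W\<^sub>\<alpha>|\<^sup>2 = 1 - \<mu> y\<close>. The proof looks at the function
  \<open>K = G\<^sup>2 / (1 + G)\<close>, holomorphic in \<open>H\<close>. Since \<open>K = G - 1 + 1 / (1 + G)\<close>, Bernoulli's law gives
  \<open>Im K = Im W\<^sub>\<alpha> (1 - 1 / |1 + W\<^sub>\<alpha>|\<^sup>2) = \<mu> y y'\<close> on the real line. Hence a suitably normalised
  primitive \<open>\<Phi>\<close> of \<open>K\<close> satisfies \<open>Im \<Phi> = (\<mu> / 2) y\<^sup>2\<close> there: the square of the elevation has become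
  the boundary value of a harmonic function \<open>v = Im \<Phi>\<close>, whose gradient \<open>|K|\<close> is in turn
  quadratic in \<open>G\<close>.

  These two facts are incompatible unless everything vanishes. By the maximum principle
  \<open>v \<ge> (\<mu> / 2) (Im F)\<^sup>2\<close> in \<open>H\<close>; combined with the Schwarz--Pick lemma this bounds the gradient of
  \<open>F\<close>, at depth \<open>\<beta>\<close>, by \<open>|G|\<^sup>2 \<le> 8 v / (\<mu> \<beta>\<^sup>2)\<close>. So \<open>|\<partial>v / \<partial>\<beta>| \<le> |K| \<le> C v / \<beta>\<^sup>2\<close>, and because
  \<open>1 / \<beta>\<^sup>2\<close> is integrable at infinity, \<open>v\<close> cannot decay to zero along a vertical line unless it
  vanishes on that line. But it does decay, as its boundary values tend to zero at infinity. Hence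
  \<open>v = 0\<close>, then \<open>G = 0\<close>, and \<open>W\<close> is constant. (For \<open>y\<close> in \<open>L\<^sup>2\<close> one has
  \<open>v \<approx> \<mu> / (2 \<pi> \<beta>) \<integral> y\<^sup>2\<close> at great depth, and the argument amounts to the Pohozaev identity
  \<open>\<integral> y\<^sup>2 = 0\<close> for Babenko's equation, which is what one gets by testing with \<open>\<alpha> W\<^sub>\<alpha>\<close>.) This is
  \<open>half_plane_square_flux_imp_deriv_zero\<close>; the case \<open>c = 0\<close>, where \<open>y = 0\<close>, falls under it with
  \<open>\<Phi> = 0\<close>.

  The Besov regularity enters through \<open>besov_half_2_1_vanishing\<close>: \<open>W\<^sub>\<alpha>\<close> is uniformly continuous and
  tends to zero at infinity, because each \<open>P\<^sub>k W\<^sub>\<alpha>\<close> is square integrable and Lipschitz on small scales.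
  Maximum principles of Phragmen--Lindelof type carry this over to \<open>F'\<close>: it extends continuously to
  the closed half plane with boundary values \<open>W\<^sub>\<alpha>\<close>, tends to zero at infinity, and
  \<open>|1 + F'| \<ge> \<delta>\<close>, so that \<open>K\<close> and \<open>\<Phi>\<close> are under control up to the boundary.
\<close>

section \<open>Decay of functions in the critical Besov space\<close>

lemma integrable_compact_support:
  fixes f :: "real \<Rightarrow> complex"
  assumes cont: "continuous_on UNIV f" and supp: "\<And>x. b < \<bar>x\<bar> \<Longrightarrow> f x = 0"
  shows "integrable lborel f"
    and "(LINT x|lborel. f x) = (LINT x|lborel. indicator {-b..b} x *\<^sub>R f x)"
proof -
  have *: "(\<lambda>x. indicator {-b..b} x *\<^sub>R f x) = f"
    using supp by (force simp: indicator_def)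
  have "integrable lborel (\<lambda>x. indicator {-b..b} x *\<^sub>R f x)"
    by (rule borel_integrable_compact) (use cont continuous_on_subset in blast)+
  then show "integrable lborel f" "(LINT x|lborel. f x) = (LINT x|lborel. indicator {-b..b} x *\<^sub>R f x)"
    unfolding * by simp_all
qed

lemma norm_integral_compact_support_le:
  fixes f :: "real \<Rightarrow> complex"
  assumes cont: "continuous_on UNIV f" and supp: "\<And>x. b < \<bar>x\<bar> \<Longrightarrow> f x = 0"
    and bd: "\<And>x. cmod (f x) \<le> A" and b: "0 \<le> b"
  shows "cmod (LINT x|lborel. f x) \<le> 2 * b * A"
proof -
  have "cmod (LINT x|lborel. f x) \<le> (LINT x|lborel. cmod (f x))"
    by (rule integral_norm_bound)
  also have "\<dots> \<le> (LINT x|lborel. indicator {-b..b} x * A)"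
  proof (rule integral_mono)
    show "integrable lborel (\<lambda>x. cmod (f x))"
      using integrable_compact_support(1)[OF cont supp] by simp
    show "cmod (f x) \<le> indicator {-b..b} x * A" for x
      using bd[of x] supp[of x] by (cases "b < \<bar>x\<bar>") (auto simp: indicator_def)
  qed (auto intro!: integrable_mult_left integrable_real_indicator simp: emeasure_lborel_Icc_eq)
  also have "\<dots> = 2 * b * A" using b by simp
  finally show ?thesis .
qed

text \<open>
  Integration by parts: \<open>m \<xi> * cis (x * \<xi>)\<close> has compact support, so the integral of its derivative
  vanishes.
\<close>

lemma Fourier_integral_derivative:
  fixes m m' :: "real \<Rightarrow> complex"
  assumes der: "\<And>\<xi>. (m has_vector_derivative m' \<xi>) (at \<xi>)"
    and cont': "continuous_on UNIV m'"
    and supp: "\<And>\<xi>. b < \<bar>\<xi>\<bar> \<Longrightarrow> m \<xi> = 0" and supp': "\<And>\<xi>. b < \<bar>\<xi>\<bar> \<Longrightarrow> m' \<xi> = 0"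
    and b: "0 \<le> b"
  shows "(LINT \<xi>|lborel. m' \<xi> * cis (x * \<xi>)) = - (\<i> * x * (LINT \<xi>|lborel. m \<xi> * cis (x * \<xi>)))"
proof -
  have cm: "continuous_on UNIV m"
    using der by (meson continuous_at_imp_continuous_on has_vector_derivative_continuous)
  have cc: "continuous_on UNIV (\<lambda>\<xi>. cis (x * \<xi>))"
    by (intro continuous_intros)
  have i1: "integrable lborel (\<lambda>\<xi>. m \<xi> * cis (x * \<xi>))"
    by (rule integrable_compact_support(1)[where b = b]) (use cm cc supp in \<open>auto intro!: continuous_intros\<close>)
  have i2: "integrable lborel (\<lambda>\<xi>. m' \<xi> * cis (x * \<xi>))"
    by (rule integrable_compact_support(1)[where b = b]) (use cont' cc supp' in \<open>auto intro!: continuous_intros\<close>)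
  let ?g = "\<lambda>\<xi>. m' \<xi> * cis (x * \<xi>) + \<i> * x * (m \<xi> * cis (x * \<xi>))"
  have cg: "continuous_on UNIV ?g"
    by (intro continuous_intros cm cont')
  have dcis: "((\<lambda>\<xi>. cis (x * \<xi>)) has_vector_derivative \<i> * x * cis (x * \<xi>)) (at \<xi>)" for \<xi>
    unfolding cis_conv_exp
    by (auto intro!: derivative_eq_intros has_vector_derivative_real_field simp: field_simps)
  have "(LINT \<xi>|lborel. ?g \<xi>) = (LINT \<xi>|lborel. indicator {-(b+1)..b+1} \<xi> *\<^sub>R ?g \<xi>)"
    by (rule integrable_compact_support(2)) (use cg supp supp' in auto)
  also have "\<dots> = m (b+1) * cis (x * (b+1)) - m (-(b+1)) * cis (x * (-(b+1)))"
  proof (rule integral_FTC_Icc)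
    show "((\<lambda>\<xi>. m \<xi> * cis (x * \<xi>)) has_vector_derivative ?g \<xi>) (at \<xi> within {-(b+1)..b+1})" for \<xi>
      using has_vector_derivative_mult[OF der dcis, of \<xi>]
      by (auto intro: has_vector_derivative_at_within simp: algebra_simps)
    show "continuous_on {-(b+1)..b+1} ?g"
      using cg continuous_on_subset by blast
  qed (use b in auto)
  also have "\<dots> = 0" using supp b by simp
  finally show ?thesis
    using i1 i2 by (simp add: eq_neg_iff_add_eq_0)
qed

text \<open>
  Two integrations by parts give the factor \<open>x\<^sup>2\<close>, the trivial bound gives the factor 1. The constant
  depends only on the support of \<open>m\<close> and on the size of \<open>m\<close> and \<open>m''\<close>, so that the bound can be
  applied to a family of symbols, as in the next lemma.
\<close>

lemma Fourier_integral_decay: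
  fixes m m' m'' :: "real \<Rightarrow> complex"
  assumes der: "\<And>\<xi>. (m has_vector_derivative m' \<xi>) (at \<xi>)"
    and der': "\<And>\<xi>. (m' has_vector_derivative m'' \<xi>) (at \<xi>)"
    and cont'': "continuous_on UNIV m''"
    and supp: "\<And>\<xi>. b < \<bar>\<xi>\<bar> \<Longrightarrow> m \<xi> = 0 \<and> m' \<xi> = 0 \<and> m'' \<xi> = 0"
    and b: "0 \<le> b"
    and bd: "\<And>\<xi>. cmod (m \<xi>) \<le> A" "\<And>\<xi>. cmod (m'' \<xi>) \<le> A"
  shows "cmod (LINT \<xi>|lborel. m \<xi> * cis (x * \<xi>)) \<le> 4 * b * A / (1 + x\<^sup>2)"
proof -
  have cm: "continuous_on UNIV m" "continuous_on UNIV m'"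
    using der der' by (meson continuous_at_imp_continuous_on has_vector_derivative_continuous)+
  let ?I = "LINT \<xi>|lborel. m \<xi> * cis (x * \<xi>)"
  have "(LINT \<xi>|lborel. m'' \<xi> * cis (x * \<xi>)) = - (\<i> * x * - (\<i> * x * ?I))"
    using Fourier_integral_derivative[OF der cm(2), of b x] Fourier_integral_derivative[OF der' cont'', of b x]
      supp b by simp
  also have "\<dots> = - (of_real (x\<^sup>2) * ?I)"
    by (simp add: power2_eq_square mult_ac)
  finally have "x\<^sup>2 * cmod ?I = cmod (LINT \<xi>|lborel. m'' \<xi> * cis (x * \<xi>))"
    by (simp add: norm_mult norm_power)
  also have "\<dots> \<le> 2 * b * A"
    by (rule norm_integral_compact_support_le)
       (use cont'' supp b bd in \<open>auto intro!: continuous_intros simp: norm_mult\<close>)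
  finally have 1: "x\<^sup>2 * cmod ?I \<le> 2 * b * A" .
  have 2: "cmod ?I \<le> 2 * b * A"
    by (rule norm_integral_compact_support_le)
       (use cm supp b bd in \<open>auto intro!: continuous_intros simp: norm_mult\<close>)
  have "cmod ?I * (1 + x\<^sup>2) \<le> 4 * b * A"
    using 1 2 by (simp add: algebra_simps)
  moreover have "0 < 1 + x\<^sup>2" by (simp add: add_pos_nonneg)
  ultimately show ?thesis
    by (simp add: pos_le_divide_eq)
qed

text \<open>
  The second estimate, a Lipschitz bound with an integrable constant, comes from applying the decay
  estimate to the symbol \<open>m0 \<xi> = \<phi> (\<xi> / 2\<^sup>k) * (cis (h * \<xi>) - 1)\<close> of the difference of
  the two translates: \<open>m0\<close> and its second derivative are bounded by a multiple of
  \<open>\<bar>h\<bar>\<close> on the support of the symbol.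
\<close>

lemma LP_kernel_estimates:
  assumes "dyadic_multiplier \<phi>"
  obtains C where "0 \<le> C" "\<And>x. cmod (LP_kernel \<phi> k x) \<le> C / (1 + x\<^sup>2)"
    "\<And>x h. \<bar>h\<bar> \<le> 1 \<Longrightarrow> cmod (LP_kernel \<phi> k (x + h) - LP_kernel \<phi> k x) \<le> \<bar>h\<bar> * (C / (1 + x\<^sup>2))"
proof -
  define s :: real where "s = 1 / 2 powi k"
  have s: "s > 0" by (simp add: s_def)
  from assms obtain b0 where b0: "b0 > 0" "\<And>\<xi>. \<phi> \<xi> \<noteq> 0 \<Longrightarrow> \<bar>\<xi>\<bar> \<le> b0"
    unfolding dyadic_multiplier_def by (metis less_trans)
  define p where "p n \<xi> = s ^ n * (deriv ^^ n) \<phi> (s * \<xi>)" for n \<xi>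
  have p0: "p 0 \<xi> = \<phi> (\<xi> / 2 powi k)" for \<xi>
    by (simp add: p_def s_def)
  have dp: "(p n has_real_derivative p (Suc n) \<xi>) (at \<xi>)" for n \<xi>
  proof -
    have "(deriv ^^ n) \<phi> differentiable (at (s * \<xi>))"
      using assms by (auto simp: dyadic_multiplier_def differentiable_on_def)
    then have "((deriv ^^ n) \<phi> has_real_derivative (deriv ^^ Suc n) \<phi> (s * \<xi>)) (at (s * \<xi>))"
      by (simp add: DERIV_deriv_iff_real_differentiable)
    then have "((\<lambda>\<xi>. (deriv ^^ n) \<phi> (s * \<xi>)) has_real_derivative (deriv ^^ Suc n) \<phi> (s * \<xi>) * s) (at \<xi>)"
      by (rule DERIV_chain2) (auto intro!: derivative_eq_intros)
    then have "((\<lambda>\<xi>. s ^ n * (deriv ^^ n) \<phi> (s * \<xi>)) has_real_derivative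
        s ^ n * ((deriv ^^ Suc n) \<phi> (s * \<xi>) * s)) (at \<xi>)"
      by (rule DERIV_cmult)
    then show ?thesis
      by (simp add: p_def[abs_def] mult_ac)
  qed
  define b where "b = max 1 (b0 / s)"
  have b: "1 \<le> b" by (simp add: b_def)
  have supp: "p n \<xi> = 0" if "b < \<bar>\<xi>\<bar>" for n \<xi>
    using that
  proof (induction n arbitrary: \<xi>)
    case 0
    then have "b0 < \<bar>s * \<xi>\<bar>"
      using s by (simp add: b_def abs_mult field_simps)
    then show ?case using b0(2)[of "s * \<xi>"] by (auto simp: p_def)
  next
    case (Suc n)
    have "open {\<xi>::real. b < \<bar>\<xi>\<bar>}"
      by (intro open_Collect_less continuous_intros)
    then have "(p n has_real_derivative 0) (at \<xi>)"
      using Suc by (intro has_field_derivative_transform_within_open[OF DERIV_const[of 0], of "{\<xi>. b < \<bar>\<xi>\<bar>}"]) auto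
    then show ?case
      using dp DERIV_unique by blast
  qed
  have cp: "continuous_on UNIV (p n)" for n
    using DERIV_isCont[OF dp] by (auto intro!: continuous_at_imp_continuous_on)
  have "\<exists>A. \<forall>\<xi>. \<bar>p n \<xi>\<bar> \<le> A" for n
  proof -
    have "compact (p n ` {-b..b})"
      by (intro compact_continuous_image continuous_on_subset[OF cp]) auto
    then obtain A where A: "\<And>\<xi>. \<xi> \<in> {-b..b} \<Longrightarrow> \<bar>p n \<xi>\<bar> \<le> A"
      using compact_imp_bounded bounded_iff by (metis imageI real_norm_def)
    have "\<bar>p n \<xi>\<bar> \<le> max A 0" for \<xi>
    proof (cases "b < \<bar>\<xi>\<bar>")
      case False
      then have "\<xi> \<in> {-b..b}" by (auto simp: abs_le_iff not_less)
      then show ?thesis using A[of \<xi>] by simp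
    qed (use supp in auto)
    then show ?thesis by blast
  qed
  then obtain Af where Af: "\<And>n \<xi>. \<bar>p n \<xi>\<bar> \<le> Af n" by metis
  define A where "A = Af 0 + Af 1 + Af 2"
  have Afn: "0 \<le> Af n" for n using Af[of n 0] by linarith
  have A: "\<bar>p 0 \<xi>\<bar> \<le> A" "\<bar>p (Suc 0) \<xi>\<bar> \<le> A" "\<bar>p (Suc (Suc 0)) \<xi>\<bar> \<le> A" for \<xi>
    using Af[of 0 \<xi>] Af[of 1 \<xi>] Af[of 2 \<xi>] Afn[of 0] Afn[of 1] Afn[of 2]
    by (auto simp: A_def numeral_2_eq_2)
  have A0: "0 \<le> A" using A(1)[of 0] by linarith
  have dpc: "((\<lambda>\<xi>. complex_of_real (p n \<xi>)) has_vector_derivative of_real (p (Suc n) \<xi>)) (at \<xi>)" for n \<xi>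
    using dp[of n \<xi>] has_vector_derivative_of_real[of "p n"]
    by (simp add: has_real_derivative_iff_has_vector_derivative)
  define C where "C = 4 * b * (A * (b + 3))"
  have C0: "0 \<le> C" using b A0 by (simp add: C_def)
  have Kint: "integrable lborel (\<lambda>\<xi>. complex_of_real (p 0 \<xi>) * cis (x * \<xi>))" for x
    by (rule integrable_compact_support(1)[where b = b])
       (use cp supp in \<open>auto intro!: continuous_intros\<close>)
  have K: "LP_kernel \<phi> k x = (LINT \<xi>|lborel. complex_of_real (p 0 \<xi>) * cis (x * \<xi>)) / (2 * of_real pi)" for x
    by (simp add: LP_kernel_def p0)
  have div_pi: "cmod (z / (2 * of_real pi)) \<le> c" if "cmod z \<le> c" for z c
  proof -
    have "cmod (z / (2 * of_real pi)) = cmod z / (2 * pi)"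
      by (simp add: norm_divide norm_mult)
    also have "\<dots> \<le> cmod z / 1"
      using pi_gt3 by (intro divide_left_mono) auto
    finally show ?thesis using that by simp
  qed
  have "cmod (LP_kernel \<phi> k x) \<le> C / (1 + x\<^sup>2)" for x
  proof -
    have "cmod (LINT \<xi>|lborel. complex_of_real (p 0 \<xi>) * cis (x * \<xi>)) \<le> 4 * b * A / (1 + x\<^sup>2)"
      by (rule Fourier_integral_decay[OF dpc dpc]) (use cp supp A b in \<open>auto intro!: continuous_intros\<close>)
    also have "\<dots> \<le> C / (1 + x\<^sup>2)"
      using b A0 by (intro divide_right_mono) (auto simp: C_def algebra_simps mult_left_mono)
    finally show ?thesis unfolding K by (rule div_pi)
  qed
  moreover have "cmod (LP_kernel \<phi> k (x + h) - LP_kernel \<phi> k x) \<le> \<bar>h\<bar> * (C / (1 + x\<^sup>2))"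
    if h: "\<bar>h\<bar> \<le> 1" for x h
  proof -
    let ?e = "\<lambda>\<xi>. cis (h * \<xi>)"
    let ?c = "\<lambda>n \<xi>. complex_of_real (p n \<xi>)"
    let ?m0 = "\<lambda>\<xi>. ?c 0 \<xi> * (?e \<xi> - 1)"
    let ?m1 = "\<lambda>\<xi>. ?c 1 \<xi> * (?e \<xi> - 1) + ?c 0 \<xi> * (\<i> * h * ?e \<xi>)"
    let ?m2 = "\<lambda>\<xi>. ?c 2 \<xi> * (?e \<xi> - 1) + 2 * (?c 1 \<xi> * (\<i> * h * ?e \<xi>)) - ?c 0 \<xi> * (h\<^sup>2 * ?e \<xi>)"
    have de: "(?e has_vector_derivative \<i> * h * ?e \<xi>) (at \<xi>)" for \<xi>
      unfolding cis_conv_exp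
      by (auto intro!: derivative_eq_intros has_vector_derivative_real_field simp: field_simps)
    have e1: "cmod (?e \<xi> - 1) \<le> \<bar>h\<bar> * \<bar>\<xi>\<bar>" for \<xi>
      unfolding cis_conv_exp dist_exp_i_1 using abs_sin_x_le_abs_x[of "h * \<xi> / 2"]
      by (simp add: abs_mult)
    have pe: "cmod (?c n \<xi> * (?e \<xi> - 1)) \<le> A * (\<bar>h\<bar> * b)" if "\<bar>p n \<xi>\<bar> \<le> A" for n \<xi>
    proof (cases "b < \<bar>\<xi>\<bar>")
      case True
      then show ?thesis using supp A0 b by simp
    next
      case False
      have "cmod (?e \<xi> - 1) \<le> \<bar>h\<bar> * b"
        using e1[of \<xi>] False by (meson abs_ge_zero mult_left_mono not_le order_trans)
      then show ?thesis
        unfolding norm_mult using that A0 by (intro mult_mono) auto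
    qed
    have m0: "cmod (?m0 \<xi>) \<le> A * (\<bar>h\<bar> * (b + 3))" for \<xi>
      by (rule order_trans[OF pe[of 0 \<xi>, OF A(1)]]) (use A0 in \<open>auto intro!: mult_left_mono\<close>)
    have m2: "cmod (?m2 \<xi>) \<le> A * (\<bar>h\<bar> * (b + 3))" for \<xi>
    proof -
      have "cmod (?m2 \<xi>) \<le> cmod (?c 2 \<xi> * (?e \<xi> - 1)) + cmod (2 * (?c 1 \<xi> * (\<i> * h * ?e \<xi>)))
          + cmod (?c 0 \<xi> * (h\<^sup>2 * ?e \<xi>))"
        by (rule order_trans[OF norm_triangle_ineq4 add_right_mono[OF norm_triangle_ineq]])
      also have "cmod (2 * (?c 1 \<xi> * (\<i> * h * ?e \<xi>))) = 2 * (\<bar>p 1 \<xi>\<bar> * \<bar>h\<bar>)"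
        by (simp add: norm_mult)
      also have "cmod (?c 0 \<xi> * (h\<^sup>2 * ?e \<xi>)) = \<bar>p 0 \<xi>\<bar> * (\<bar>h\<bar> * \<bar>h\<bar>)"
        by (simp add: norm_mult norm_power power2_eq_square)
      also have "\<bar>p 0 \<xi>\<bar> * (\<bar>h\<bar> * \<bar>h\<bar>) \<le> A * (\<bar>h\<bar> * 1)"
        using A h A0 by (intro mult_mono) auto
      also have "\<bar>p 1 \<xi>\<bar> * \<bar>h\<bar> \<le> A * \<bar>h\<bar>"
        using A(2) by (intro mult_right_mono) auto
      also have "cmod (?c 2 \<xi> * (?e \<xi> - 1)) \<le> A * (\<bar>h\<bar> * b)"
        by (rule pe) (use A(3) in \<open>simp add: numeral_2_eq_2\<close>)
      finally show ?thesis by (simp add: algebra_simps)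
    qed
    have "cmod (LINT \<xi>|lborel. ?m0 \<xi> * cis (x * \<xi>)) \<le> 4 * b * (A * (\<bar>h\<bar> * (b + 3))) / (1 + x\<^sup>2)"
    proof (rule Fourier_integral_decay[where m' = ?m1 and m'' = ?m2 and b = b])
      show "(?m0 has_vector_derivative ?m1 \<xi>) (at \<xi>)" for \<xi>
        using has_vector_derivative_mult[OF dpc has_vector_derivative_diff[OF de has_vector_derivative_const[of 1]], of 0 \<xi>]
        by (simp add: add.commute)
      have "(?m1 has_vector_derivative
          (?c 1 \<xi> * (\<i> * h * ?e \<xi> - 0) + ?c 2 \<xi> * (?e \<xi> - 1)) +
          (?c 0 \<xi> * (\<i> * h * (\<i> * h * ?e \<xi>)) + ?c 1 \<xi> * (\<i> * h * ?e \<xi>))) (at \<xi>)" for \<xi>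
        using dpc[of 0 \<xi>] dpc[of "Suc 0" \<xi>] 
        by (intro has_vector_derivative_add has_vector_derivative_mult has_vector_derivative_diff
            has_vector_derivative_const has_vector_derivative_mult_right de) (simp_all add: numeral_2_eq_2)
      then show "(?m1 has_vector_derivative ?m2 \<xi>) (at \<xi>)" for \<xi>
        by (rule has_vector_derivative_eq_rhs) (simp add: algebra_simps power2_eq_square)
      show "continuous_on UNIV ?m2"
        by (intro continuous_intros cp)
    qed (use supp b m0 m2 in auto)
    also have "4 * b * (A * (\<bar>h\<bar> * (b + 3))) / (1 + x\<^sup>2) = \<bar>h\<bar> * (C / (1 + x\<^sup>2))"
      by (simp add: C_def)
    also have "(LINT \<xi>|lborel. ?m0 \<xi> * cis (x * \<xi>)) =
        (LINT \<xi>|lborel. ?c 0 \<xi> * cis ((x + h) * \<xi>) - ?c 0 \<xi> * cis (x * \<xi>))"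
      by (intro Bochner_Integration.integral_cong) (simp_all add: algebra_simps flip: cis_mult)
    also have "\<dots> = (LINT \<xi>|lborel. ?c 0 \<xi> * cis ((x + h) * \<xi>)) - (LINT \<xi>|lborel. ?c 0 \<xi> * cis (x * \<xi>))"
      by (rule Bochner_Integration.integral_diff[OF Kint Kint])
    finally show ?thesis
      unfolding K diff_divide_distrib[symmetric] by (rule div_pi)
  qed
  ultimately show ?thesis by (rule that[OF C0])
qed

lemma integrable_inverse_1_plus_square_UNIV:
  "integrable lborel (\<lambda>x::real. 1 / (1 + x\<^sup>2))"
  using integrable_inverse_1_plus_square by (simp add: set_integrable_def inverse_eq_divide)

text \<open>
  Translating \<open>P\<^sub>k u\<close> by \<open>h\<close> amounts to translating the kernel, which changes it by at most
  \<open>\<bar>h\<bar>\<close> times an integrable function, and \<open>u\<close> is bounded.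
\<close>

lemma LP_proj_uniformly_continuous:
  assumes \<phi>: "dyadic_multiplier \<phi>"
    and cont: "continuous_on UNIV u" and bdd: "bounded (range u)"
  shows "uniformly_continuous_on UNIV (LP_proj \<phi> k u)"
proof -
  obtain C where C: "0 \<le> C" "\<And>x. cmod (LP_kernel \<phi> k x) \<le> C / (1 + x\<^sup>2)"
    "\<And>x h. \<bar>h\<bar> \<le> 1 \<Longrightarrow> cmod (LP_kernel \<phi> k (x + h) - LP_kernel \<phi> k x) \<le> \<bar>h\<bar> * (C / (1 + x\<^sup>2))"
    using LP_kernel_estimates[OF \<phi>] by blast
  let ?K = "LP_kernel \<phi> k"
  obtain U where U: "\<And>y. cmod (u y) \<le> U" using bdd unfolding bounded_iff by auto
  have U0: "0 \<le> U" using U[of 0] norm_ge_zero order_trans by blast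
  have contK: "continuous_on UNIV ?K"
  proof (intro continuous_at_imp_continuous_on ballI)
    fix x
    have "((\<lambda>h. \<bar>h\<bar> * (C / (1 + x\<^sup>2))) \<longlongrightarrow> \<bar>0\<bar> * (C / (1 + x\<^sup>2))) (at 0)"
      by (intro tendsto_intros)
    then have lim0: "((\<lambda>h. \<bar>h\<bar> * (C / (1 + x\<^sup>2))) \<longlongrightarrow> 0) (at 0)" by simp
    have ev: "\<forall>\<^sub>F h in at 0. cmod (?K (x + h) - ?K x) \<le> \<bar>h\<bar> * (C / (1 + x\<^sup>2))"
      unfolding eventually_at using C(3)[of _ x] by (intro exI[of _ 1]) (simp add: dist_real_def)
    have "((\<lambda>h. ?K (x + h) - ?K x) \<longlongrightarrow> 0) (at 0)"
      by (rule Lim_null_comparison[OF ev lim0])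
    then show "isCont ?K x"
      by (simp add: isCont_def LIM_zero_cancel LIM_offset_zero_iff)
  qed
  define P where "P x y = C * U / (1 + (x - y)\<^sup>2)" for x y :: real
  have Pint: "integrable lborel (P x)" for x
    using lborel_integrable_real_affine[OF integrable_inverse_1_plus_square_UNIV, of "-1" x]
    by (auto simp: P_def[abs_def] divide_inverse)
  have meas: "(\<lambda>y. ?K (x - y) * u y) \<in> borel_measurable lborel" for x
  proof -
    have "continuous_on UNIV (\<lambda>y. ?K (x - y) * u y)"
      by (intro continuous_intros cont continuous_on_compose2[OF contK]) auto
    then show ?thesis by (simp add: borel_measurable_continuous_onI)
  qed
  have Kint: "integrable lborel (\<lambda>y. ?K (x - y) * u y)" for x
  proof (rule Bochner_Integration.integrable_bound[OF Pint meas], rule AE_I2)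
    fix y
    show "cmod (?K (x - y) * u y) \<le> norm (P x y)"
      using mult_mono[OF C(2)[of "x - y"] U[of y]] C(1) U0 by (simp add: norm_mult P_def)
  qed
  have PI: "(LINT y|lborel. P x y) = (LINT y|lborel. P 0 y)" for x
    using lborel_integral_real_affine[of 1 "P x" x] by (simp add: P_def)
  have est: "cmod (LP_proj \<phi> k u (x + h) - LP_proj \<phi> k u x) \<le> \<bar>h\<bar> * (LINT y|lborel. P 0 y)"
    if h: "\<bar>h\<bar> \<le> 1" for x h
  proof -
    have "LP_proj \<phi> k u (x + h) - LP_proj \<phi> k u x = (LINT y|lborel. ?K (x + h - y) * u y - ?K (x - y) * u y)"
      unfolding LP_proj_def by (rule Bochner_Integration.integral_diff[OF Kint Kint, symmetric])
    also have "cmod \<dots> \<le> (LINT y|lborel. cmod (?K (x + h - y) * u y - ?K (x - y) * u y))"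
      by (rule integral_norm_bound)
    also have "\<dots> \<le> (LINT y|lborel. \<bar>h\<bar> * P x y)"
    proof (rule integral_mono)
      show "integrable lborel (\<lambda>y. cmod (?K (x + h - y) * u y - ?K (x - y) * u y))"
        by (intro integrable_norm Bochner_Integration.integrable_diff Kint)
      show "integrable lborel (\<lambda>y. \<bar>h\<bar> * P x y)"
        by (intro integrable_mult_right Pint)
      show "cmod (?K (x + h - y) * u y - ?K (x - y) * u y) \<le> \<bar>h\<bar> * P x y" for y
      proof -
        have eq: "x + h - y = (x - y) + h" by simp
        have "cmod (?K (x + h - y) * u y - ?K (x - y) * u y) = cmod (?K ((x - y) + h) - ?K (x - y)) * cmod (u y)"
          by (simp only: eq norm_mult[symmetric] left_diff_distrib)
        also have "\<dots> \<le> (\<bar>h\<bar> * (C / (1 + (x - y)\<^sup>2))) * U"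
          using C(1) by (intro mult_mono C(3) h U) auto
        finally show ?thesis by (simp add: P_def)
      qed
    qed
    also have "\<dots> = \<bar>h\<bar> * (LINT y|lborel. P 0 y)" by (simp add: PI[of x])
    finally show ?thesis .
  qed
  define I where "I = (LINT y|lborel. P 0 y)"
  have I0: "0 \<le> I" unfolding I_def P_def using C(1) U0 by (intro Bochner_Integration.integral_nonneg) auto
  show ?thesis
  proof (unfold uniformly_continuous_on_def, intro allI impI)
    fix e :: real assume e: "e > 0"
    define d where "d = min 1 (e / (I + 1))"
    have "d > 0" using e I0 by (simp add: d_def)
    moreover have "dist (LP_proj \<phi> k u x') (LP_proj \<phi> k u x) < e" if "dist x' x < d" for x x'
    proof -
      have h: "\<bar>x' - x\<bar> < 1" "\<bar>x' - x\<bar> < e / (I + 1)"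
        using that by (auto simp: d_def dist_real_def)
      have "dist (LP_proj \<phi> k u x') (LP_proj \<phi> k u x) \<le> \<bar>x' - x\<bar> * I"
        using est[of "x' - x" x] h by (simp add: dist_norm I_def)
      also have "\<dots> \<le> \<bar>x' - x\<bar> * (I + 1)"
        by (intro mult_left_mono) auto
      also have "\<dots> < e" using h(2) I0 by (simp add: less_divide_eq)
      finally show ?thesis .
    qed
    ultimately show "\<exists>d>0. \<forall>x\<in>UNIV. \<forall>x'\<in>UNIV. dist x' x < d \<longrightarrow> dist (LP_proj \<phi> k u x') (LP_proj \<phi> k u x) < e"
      by blast
  qed
qed

text \<open>
  A value of size \<open>e\<close> persists, up to a factor 2, on an interval of fixed length \<open>2 * r\<close>, which far
  out would contradict the smallness of the tail of the integral.
\<close>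

lemma square_integrable_imp_vanishing:
  assumes uc: "uniformly_continuous_on UNIV f" and L2: "square_integrable f"
  shows "(f \<longlongrightarrow> 0) at_infinity"
proof (rule tendstoI)
  fix e :: real assume e: "e > 0"
  obtain d where d: "d > 0" and dd: "\<And>x y. dist y x < d \<Longrightarrow> dist (f y) (f x) < e / 2"
    using uc e unfolding uniformly_continuous_on_def by (meson UNIV_I half_gt_zero)
  define r where "r = min (d / 2) 1"
  have r: "0 < r" "r < d" "r \<le> 1" using d by (auto simp: r_def)
  have g: "integrable lborel (\<lambda>x. (cmod (f x))\<^sup>2)" "f \<in> borel_measurable borel"
    using L2 by (auto simp: square_integrable_def)
  let ?t = "\<lambda>n::nat. \<lambda>x. indicator {x. real n < \<bar>x\<bar>} x * (cmod (f x))\<^sup>2"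
  have mt: "?t n \<in> borel_measurable lborel" for n
    using g(2) by measurable
  have "(\<lambda>n. LINT x|lborel. ?t n x) \<longlonglongrightarrow> integral\<^sup>L lborel (\<lambda>x::real. 0::real)"
  proof (rule integral_dominated_convergence[where s = ?t and f = "\<lambda>_. 0" and w = "\<lambda>x. (cmod (f x))\<^sup>2"])
    show "AE x in lborel. (\<lambda>n. ?t n x) \<longlonglongrightarrow> 0"
    proof (rule AE_I2)
      fix x :: real
      have "\<forall>\<^sub>F n in sequentially. real n \<ge> \<bar>x\<bar>"
        using filterlim_real_sequentially by (simp add: filterlim_at_top)
      then have "\<forall>\<^sub>F n in sequentially. ?t n x = 0"
        by eventually_elim auto
      then show "(\<lambda>n. ?t n x) \<longlonglongrightarrow> 0" by (rule tendsto_eventually)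
    qed
  qed (use mt g in \<open>auto simp: indicator_def\<close>)
  then have "\<forall>\<^sub>F n in sequentially. (LINT x|lborel. ?t n x) < 2 * r * (e / 2)\<^sup>2"
    using r e by (intro order_tendstoD(2)) auto
  then obtain n where n: "(LINT x|lborel. ?t n x) < 2 * r * (e / 2)\<^sup>2"
    by (meson eventually_happens sequentially_bot)
  have tint: "integrable lborel (?t n)"
    by (rule Bochner_Integration.integrable_bound[OF g(1) mt]) (auto simp: indicator_def)
  have "cmod (f x) < e" if x: "real n + 1 < \<bar>x\<bar>" for x
  proof (rule ccontr)
    assume "\<not> cmod (f x) < e"
    then have big: "e / 2 \<le> cmod (f y)" if "\<bar>y - x\<bar> \<le> r" for y
      using dd[of y x] that r norm_triangle_ineq2[of "f x" "f y"]
      by (simp add: dist_norm norm_minus_commute)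
    have "2 * r * (e / 2)\<^sup>2 = (LINT y|lborel. indicator {x - r..x + r} y * (e / 2)\<^sup>2)"
      using r by simp
    also have "\<dots> \<le> (LINT y|lborel. ?t n y)"
    proof (rule integral_mono[OF _ tint])
      show "integrable lborel (\<lambda>y. indicator {x - r..x + r} y * (e / 2)\<^sup>2)"
        by (auto intro!: integrable_mult_left integrable_real_indicator simp: emeasure_lborel_Icc_eq)
      show "indicator {x - r..x + r} y * (e / 2)\<^sup>2 \<le> ?t n y" for y
      proof (cases "y \<in> {x - r..x + r}")
        case True
        then have "\<bar>y - x\<bar> \<le> r" by auto
        moreover from this have "real n < \<bar>y\<bar>" using x r by linarith
        moreover have "(e / 2)\<^sup>2 \<le> (cmod (f y))\<^sup>2"
          using big[OF \<open>\<bar>y - x\<bar> \<le> r\<close>] e by (intro power_mono) auto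
        ultimately show ?thesis using True by simp
      qed auto
    qed
    finally show False using n by simp
  qed
  then show "\<forall>\<^sub>F x in at_infinity. dist (f x) 0 < e"
    unfolding eventually_at_infinity by (intro exI[of _ "real n + 2"]) auto
qed

text \<open>
  Both properties pass from the pieces \<open>P\<^sub>k u\<close> to finite sums, and then to the uniform limit of
  these.
\<close>

lemma besov_half_2_1_vanishing:
  assumes \<phi>: "dyadic_multiplier \<phi>" and u: "u \<in> besov_half_2_1 \<phi>"
  shows "uniformly_continuous_on UNIV u" and "(u \<longlongrightarrow> 0) at_infinity"
proof -
  have cont: "continuous_on UNIV u" and bdd: "bounded (range u)"
    and L2: "\<And>k. square_integrable (LP_proj \<phi> k u)"
    and lim: "uniform_limit UNIV (\<lambda>K x. \<Sum>k\<in>K. LP_proj \<phi> k u x) u (finite_subsets_at_top UNIV)"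
    using u by (auto simp: besov_half_2_1_def)
  have uc: "uniformly_continuous_on UNIV (LP_proj \<phi> k u)" for k
    by (rule LP_proj_uniformly_continuous[OF \<phi> cont bdd])
  have approx: "\<exists>K. \<forall>x. dist (\<Sum>k\<in>K. LP_proj \<phi> k u x) (u x) < e" if "e > 0" for e
    using eventually_happens'[OF finite_subsets_at_top_neq_bot uniform_limitD[OF lim that]] by auto
  have sum_uc: "uniformly_continuous_on UNIV (\<lambda>x. \<Sum>k\<in>K. LP_proj \<phi> k u x)" for K
    by (induction K rule: infinite_finite_induct)
       (auto intro!: uniformly_continuous_on_add uc uniformly_continuous_on_const)
  have sum_lim: "((\<lambda>x. \<Sum>k\<in>K. LP_proj \<phi> k u x) \<longlongrightarrow> 0) at_infinity" for K
    using tendsto_sum[of K "\<lambda>k. LP_proj \<phi> k u" "\<lambda>_. 0" at_infinity]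
      square_integrable_imp_vanishing[OF uc L2] by simp
  show "uniformly_continuous_on UNIV u"
  proof (unfold uniformly_continuous_on_def, intro allI impI)
    fix e :: real assume e: "e > 0"
    then obtain K where K: "\<And>x. dist (\<Sum>k\<in>K. LP_proj \<phi> k u x) (u x) < e / 3"
      using approx[of "e/3"] by auto
    obtain d where d: "d > 0" "\<And>x x'. dist x' x < d \<Longrightarrow>
        dist (\<Sum>k\<in>K. LP_proj \<phi> k u x') (\<Sum>k\<in>K. LP_proj \<phi> k u x) < e / 3"
      using sum_uc[of K] e unfolding uniformly_continuous_on_def
      by (metis UNIV_I zero_less_divide_iff zero_less_numeral)
    have "dist (u x') (u x) < e" if "dist x' x < d" for x x'
      using K[of x] K[of x'] d(2)[OF that]
        dist_triangle[of "u x'" "u x" "\<Sum>k\<in>K. LP_proj \<phi> k u x'"]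
        dist_triangle[of "\<Sum>k\<in>K. LP_proj \<phi> k u x'" "u x" "\<Sum>k\<in>K. LP_proj \<phi> k u x"]
      by (simp add: dist_commute)
    then show "\<exists>d>0. \<forall>x\<in>UNIV. \<forall>x'\<in>UNIV. dist x' x < d \<longrightarrow> dist (u x') (u x) < e"
      using d(1) by blast
  qed
  show "(u \<longlongrightarrow> 0) at_infinity"
  proof (rule tendstoI)
    fix e :: real assume e: "e > 0"
    then obtain K where K: "\<And>x. dist (\<Sum>k\<in>K. LP_proj \<phi> k u x) (u x) < e / 2"
      using approx[of "e/2"] by auto
    have "\<forall>\<^sub>F x in at_infinity. dist (\<Sum>k\<in>K. LP_proj \<phi> k u x) 0 < e / 2"
      using e by (intro tendstoD[OF sum_lim]) simp
    then show "\<forall>\<^sub>F x in at_infinity. dist (u x) 0 < e"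
    proof eventually_elim
      case (elim x)
      then show ?case
        using K[of x] dist_triangle[of "u x" 0 "\<Sum>k\<in>K. LP_proj \<phi> k u x"] by (simp add: dist_commute)
    qed
  qed
qed

section \<open>Maximum principles in the lower half plane\<close>

text \<open>
  The half plane is unbounded, so the maximum principle is applied on large half discs to
  \<open>f z / (1 + \<i> e z)\<close>. The denominator has modulus at least 1 in the half plane and tends to
  infinity there, which makes the values on the large arc harmless; then \<open>e\<close> tends to 0.
\<close>

lemma half_plane_bounded_max_modulus:
  fixes f :: "complex \<Rightarrow> complex"
  assumes cont: "continuous_on {z. Im z \<le> 0} f"
    and hol: "f holomorphic_on {z. Im z < 0}"
    and bdd: "\<And>z. Im z < 0 \<Longrightarrow> cmod (f z) \<le> M"
    and bdry: "\<And>x::real. cmod (f (of_real x)) \<le> B"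
    and z: "Im z < 0"
  shows "cmod (f z) \<le> B"
proof -
  have B0: "0 \<le> B"
    using bdry[of 0] norm_ge_zero order_trans by blast
  have re: "1 \<le> Re (1 + \<i> * of_real e * w)" if "0 < e" "Im w \<le> 0" for e w
    using that by (simp add: mult_nonneg_nonpos)
  have ge1: "1 \<le> cmod (1 + \<i> * of_real e * w)" if "0 < e" "Im w \<le> 0" for e w
    using re[OF that] complex_Re_le_cmod order_trans by blast
  have main: "cmod (f z) \<le> (B + e) * cmod (1 + \<i> * of_real e * z)" if e: "e > 0" for e
  proof -
    \<comment> \<open>beyond this radius \<open>|f| / |1 + \<i> e z|\<close> is at most \<open>B + e\<close> by the crude bound \<open>M\<close>\<close>
    define \<rho> where "\<rho> = max (cmod z + 1) ((\<bar>M\<bar> / (B + e) + 1) / e)"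
    define S where "S = {w. Im w < 0} \<inter> ball 0 \<rho>"
    have opS: "open S"
      unfolding S_def by (intro open_Int open_ball open_halfspace_Im_lt)
    have clS: "closure S \<subseteq> {w. Im w \<le> 0} \<inter> cball 0 \<rho>"
      unfolding S_def by (rule closure_minimal) (auto intro!: closed_Int closed_halfspace_Im_le)
    define g where "g w = f w / (1 + \<i> * of_real e * w)" for w
    have ne: "1 + \<i> * of_real e * w \<noteq> 0" if "Im w \<le> 0" for w
      using ge1[OF e that] by auto
    have "cmod (g z) \<le> B + e"
    proof (rule maximum_modulus_frontier[where f = g and S = S])
      show "g holomorphic_on interior S"
        unfolding g_def interior_open[OF opS]
        by (intro holomorphic_intros holomorphic_on_subset[OF hol])
           (use ne in \<open>auto simp: S_def\<close>)
      have c: "continuous_on {w. Im w \<le> 0} g"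
        unfolding g_def using ne by (intro continuous_intros cont) auto
      show "continuous_on (closure S) g"
        by (rule continuous_on_subset[OF c]) (use clS in auto)
      show "bounded S"
        unfolding S_def by (simp add: bounded_Int)
      show "z \<in> S"
        using z by (simp add: S_def \<rho>_def)
      fix w assume w: "w \<in> frontier S"
      then have w1: "Im w \<le> 0" "cmod w \<le> \<rho>" and "w \<notin> S"
        using clS opS by (auto simp: frontier_def interior_open)
      then consider "Im w = 0" | "Im w < 0" "cmod w = \<rho>"
        by (force simp: S_def)
      then show "cmod (g w) \<le> B + e"
      proof cases
        case 1
        then have "w = of_real (Re w)" by (simp add: complex_eq_iff)
        then have "cmod (f w) \<le> B" using bdry by metis
        moreover have "cmod (g w) \<le> cmod (f w) / 1"
          unfolding g_def norm_divide using ge1[OF e w1(1)] by (intro divide_left_mono) auto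
        ultimately show ?thesis using e by simp
      next
        case 2
        have "e * \<rho> - 1 \<ge> \<bar>M\<bar> / (B + e)"
          using e by (simp add: \<rho>_def max_def field_simps)
        moreover have "cmod (1 + \<i> * of_real e * w) \<ge> e * \<rho> - 1"
          using norm_triangle_ineq2[of "\<i> * of_real e * w" "-1"] e 2(2)
          by (simp add: norm_mult add.commute)
        ultimately have "cmod (1 + \<i> * of_real e * w) * (B + e) \<ge> \<bar>M\<bar>"
          using e B0 by (simp add: divide_le_eq) (erule order_trans[OF _ mult_right_mono], auto)
        then have "cmod (f w) \<le> (B + e) * cmod (1 + \<i> * of_real e * w)"
          using bdd[OF 2(1)] by (simp add: mult.commute)
        then show ?thesis
          unfolding g_def norm_divide using ge1[OF e w1(1)]
          by (subst pos_divide_le_eq) auto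
      qed
    qed
    then show ?thesis
      unfolding g_def norm_divide using ge1[OF e, of z] z by (subst (asm) pos_divide_le_eq) auto
  qed
  have "((\<lambda>e. (B + e) * cmod (1 + \<i> * of_real e * z)) \<longlongrightarrow> (B + 0) * cmod (1 + \<i> * of_real 0 * z)) (at_right 0)"
    by (intro tendsto_intros)
  moreover have "\<forall>\<^sub>F e in at_right 0. cmod (f z) \<le> (B + e) * cmod (1 + \<i> * of_real e * z)"
    using main by (auto simp: eventually_at_filter)
  ultimately have "cmod (f z) \<le> (B + 0) * cmod (1 + \<i> * of_real 0 * z)"
    by (rule tendsto_lowerbound) simp
  then show ?thesis by simp
qed

text \<open>
  The estimate holds on vertical translates of the segment that lie in the open half plane. Letting
  the translates tend to the boundary takes only continuity of \<open>f\<close> itself. Taking \<open>S\<close> to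
  be a small ball about a boundary point yields the derivative of \<open>f\<close> at that point.
\<close>

lemma half_plane_mean_value:
  fixes f f' :: "complex \<Rightarrow> complex"
  assumes cont: "continuous_on {z. Im z \<le> 0} f"
    and der: "\<And>z. Im z < 0 \<Longrightarrow> (f has_field_derivative f' z) (at z)"
    and S: "open S" "convex S"
    and bd: "\<And>z. z \<in> S \<Longrightarrow> Im z < 0 \<Longrightarrow> cmod (f' z - k) \<le> M"
    and a: "a \<in> S" "Im a \<le> 0" and b: "b \<in> S" "Im b \<le> 0"
  shows "cmod (f b - f a - k * (b - a)) \<le> M * cmod (b - a)"
proof -
  let ?s = "\<lambda>z t. z - \<i> * complex_of_real t"
  have inS: "\<forall>\<^sub>F t in at_right 0. ?s z t \<in> S" if "z \<in> S" for z
  proof -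
    have "((\<lambda>t. ?s z t) \<longlongrightarrow> z - \<i> * of_real 0) (at_right 0)"
      by (intro tendsto_intros)
    then show ?thesis using S(1) that by (simp add: topological_tendstoD)
  qed
  have lim: "((\<lambda>t. f (?s z t)) \<longlongrightarrow> f z) (at_right 0)" if "Im z \<le> 0" for z
  proof -
    have "((\<lambda>t. ?s z t) \<longlongrightarrow> z - \<i> * of_real 0) (at_right 0)"
      by (intro tendsto_intros)
    then have "((\<lambda>t. ?s z t) \<longlongrightarrow> z) (at_right 0)" by simp
    moreover have "\<forall>\<^sub>F t in at_right 0. ?s z t \<in> {z. Im z \<le> 0}"
      using that by (auto simp: eventually_at_filter)
    ultimately show ?thesis
      using that by (intro continuous_on_tendsto_compose[OF cont]) auto
  qed
  have "((\<lambda>t. cmod (f (?s b t) - f (?s a t) - k * (?s b t - ?s a t))) \<longlongrightarrow>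
          cmod (f b - f a - k * (b - a))) (at_right 0)"
    using a b by (auto intro!: tendsto_eq_intros lim)
  moreover have "\<forall>\<^sub>F t in at_right 0.
      cmod (f (?s b t) - f (?s a t) - k * (?s b t - ?s a t)) \<le> M * cmod (b - a)"
    using inS[OF a(1)] inS[OF b(1)] eventually_at_right_less[of 0]
  proof eventually_elim
    case (elim t)
    have "cmod ((f (?s b t) - k * ?s b t) - (f (?s a t) - k * ?s a t)) \<le> M * cmod (?s b t - ?s a t)"
    proof (rule field_differentiable_bound[where S = "S \<inter> {z. Im z < 0}" and f' = "\<lambda>z. f' z - k"])
      show "convex (S \<inter> {z. Im z < 0})"
        using S by (intro convex_Int convex_halfspace_Im_lt)
      show "((\<lambda>z. f z - k * z) has_field_derivative f' z - k) (at z within S \<inter> {z. Im z < 0})"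
        if "z \<in> S \<inter> {z. Im z < 0}" for z
        using that by (auto intro!: derivative_eq_intros der[THEN has_field_derivative_at_within])
    qed (use elim a b bd in auto)
    then show ?case by (simp add: algebra_simps)
  qed
  ultimately show ?thesis
    by (rule tendsto_upperbound) simp
qed

text \<open>
  Decay of the derivative means that \<open>f\<close> grows more slowly than every linear function, which excludes
  the harmonic function \<open>- Im z\<close>, the obstruction to uniqueness in a half plane. It makes
  \<open>exp (- \<i> (f z + \<eta> z))\<close>, whose modulus is \<open>exp (Im (f z) + \<eta> Im z)\<close>, bounded for every \<open>\<eta> > 0\<close>, so
  that the bounded maximum principle applies.
\<close>

lemma half_plane_max_principle_Im:
  fixes f f' :: "complex \<Rightarrow> complex"
  assumes cont: "continuous_on {z. Im z \<le> 0} f"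
    and der: "\<And>z. Im z < 0 \<Longrightarrow> (f has_field_derivative f' z) (at z)"
    and bd: "\<And>z. Im z < 0 \<Longrightarrow> cmod (f' z) \<le> M"
    and decay: "\<And>\<eta>. \<eta> > 0 \<Longrightarrow> \<exists>R. \<forall>z. Im z < 0 \<longrightarrow> R \<le> cmod z \<longrightarrow> cmod (f' z) \<le> \<eta>"
    and bdry: "\<And>x::real. Im (f (of_real x)) \<le> 0"
    and z: "Im z \<le> 0"
  shows "Im (f z) \<le> 0"
proof (cases "Im z = 0")
  case True
  then have "z = of_real (Re z)" by (simp add: complex_eq_iff)
  then show ?thesis using bdry by metis
next
  case False
  with z have z: "Im z < 0" by simp
  have M0: "0 \<le> M" using order_trans[OF norm_ge_zero bd[of "-\<i>"]] by simp
  have main: "Im (f z) \<le> - \<eta> * Im z" if \<eta>: "\<eta> > 0" for \<eta>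
  proof -
    obtain R0 where R0: "\<And>z. Im z < 0 \<Longrightarrow> R0 \<le> cmod z \<Longrightarrow> cmod (f' z) \<le> \<eta>"
      using decay[OF \<eta>] by blast
    define R where "R = max R0 1"
    have growth: "Im (f w) \<le> M * R - \<eta> * Im w" if w: "Im w < 0" for w
    proof -
      define w0 where "w0 = complex_of_real (Re w)"
      \<comment> \<open>descend along the vertical line through \<open>w\<close>: the slope is at most \<open>M\<close> down to
        depth \<open>R\<close>, and at most \<open>\<eta>\<close> below\<close>
      define c where "c = Complex (Re w) (- R)"
      have seg1: "Im (f p - f q) \<le> M * cmod (p - q)" if "Im p \<le> 0" "Im q \<le> 0" for p q
        using half_plane_mean_value[OF cont der open_UNIV convex_UNIV, of 0 M q p] bd that
          abs_Im_le_cmod[of "f p - f q"] by auto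
      have seg2: "Im (f p - f q) \<le> \<eta> * cmod (p - q)" if "Im p \<le> -R" "Im q \<le> -R" for p q
      proof -
        have "cmod (f p - f q) \<le> \<eta> * cmod (p - q)"
        proof (rule field_differentiable_bound[where S = "{z. Im z \<le> -R}" and f' = f'])
          show "convex {z. Im z \<le> - R}" by (rule convex_halfspace_Im_le)
          fix v assume v: "v \<in> {z. Im z \<le> - R}"
          then have "Im v < 0" "R0 \<le> cmod v"
            using abs_Im_le_cmod[of v] by (auto simp: R_def max_def split: if_splits)
          then show "(f has_field_derivative f' v) (at v within {z. Im z \<le> - R})"
            "cmod (f' v) \<le> \<eta>"
            using der R0 by (auto intro: has_field_derivative_at_within)
        qed (use that in auto)
        then show ?thesis using abs_Im_le_cmod[of "f p - f q"] by linarith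
      qed
      have w0: "Im (f w0) \<le> 0" unfolding w0_def by (rule bdry)
      show ?thesis
      proof (cases "Im w \<ge> - R")
        case True
        have "Im (f w - f w0) \<le> M * cmod (w - w0)"
          using seg1[of w w0] w by (simp add: w0_def)
        also have "cmod (w - w0) = - Im w"
          using w by (simp add: w0_def cmod_def)
        also have "M * (- Im w) \<le> M * R"
          using True M0 by (intro mult_left_mono) auto
        finally show ?thesis using w0 mult_pos_neg[OF \<eta> w] by simp
      next
        case False
        have "Im (f w - f c) \<le> \<eta> * cmod (w - c)"
          using False by (intro seg2) (auto simp: c_def)
        moreover have "cmod (w - c) = - Im w - R"
          using False by (simp add: c_def cmod_def)
        moreover have "Im (f c - f w0) \<le> M * cmod (c - w0)"
          by (intro seg1) (auto simp: c_def w0_def R_def)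
        moreover have "cmod (c - w0) = R"
          by (simp add: c_def w0_def cmod_def R_def)
        moreover have "\<eta> * R \<ge> 0" using \<eta> by (simp add: R_def)
        ultimately show ?thesis using w0 by (simp add: algebra_simps)
      qed
    qed
    let ?g = "\<lambda>w. exp (-\<i> * (f w + of_real \<eta> * w))"
    have ng: "cmod (?g w) = exp (Im (f w) + \<eta> * Im w)" for w
      by simp
    have "cmod (?g z) \<le> 1"
    proof (rule half_plane_bounded_max_modulus[where f = ?g and M = "exp (M * R)"])
      show "continuous_on {z. Im z \<le> 0} ?g"
        by (intro continuous_intros cont)
      have "f holomorphic_on {z. Im z < 0}"
        using der by (auto simp: holomorphic_on_open open_halfspace_Im_lt)
      then show "?g holomorphic_on {z. Im z < 0}"
        by (intro holomorphic_intros)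
      show "cmod (?g w) \<le> exp (M * R)" if "Im w < 0" for w
        unfolding ng using growth[OF that] by simp
      show "cmod (?g (of_real x)) \<le> 1" for x
        unfolding ng using bdry[of x] by simp
    qed (rule z)
    then show ?thesis unfolding ng by simp
  qed
  have "((\<lambda>\<eta>. - \<eta> * Im z) \<longlongrightarrow> - 0 * Im z) (at_right 0)"
    by (intro tendsto_intros)
  moreover have "\<forall>\<^sub>F \<eta> in at_right 0. Im (f z) \<le> - \<eta> * Im z"
    using main by (auto simp: eventually_at_filter)
  ultimately have "Im (f z) \<le> - 0 * Im z"
    by (rule tendsto_lowerbound) simp
  then show ?thesis by simp
qed

section \<open>Boundary behaviour of holomorphic functions in the lower half plane\<close>

lemma Lipschitz_imp_deriv_bound:
  fixes F :: "complex \<Rightarrow> complex"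
  assumes lip: "L-lipschitz_on S F" and S: "open S" "z \<in> S"
    and der: "(F has_field_derivative F') (at z)"
  shows "cmod F' \<le> L"
proof -
  have "((\<lambda>h. z + h) \<longlongrightarrow> z + 0) (at 0)"
    by (intro tendsto_intros)
  then have "\<forall>\<^sub>F h in at 0. z + h \<in> S"
    using S by (intro topological_tendstoD) auto
  then have "\<forall>\<^sub>F h in at 0. h \<noteq> 0 \<and> z + h \<in> S"
    by (simp add: eventually_at_filter)
  then have "\<forall>\<^sub>F h in at 0. cmod ((F (z + h) - F z) / h) \<le> L"
  proof eventually_elim
    case (elim h)
    then show ?case
      using lipschitz_onD[OF lip, of "z + h" z] S(2) by (simp add: norm_divide dist_norm divide_le_eq)
  qed
  moreover have "((\<lambda>h. (F (z + h) - F z) / h) \<longlongrightarrow> F') (at 0)"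
    using der by (simp add: DERIV_def)
  ultimately show ?thesis
    by (intro tendsto_upperbound[OF tendsto_norm]) auto
qed

text \<open>
  The horizontal difference quotients of \<open>F\<close> are continuous up to the boundary, bounded by the Lipschitz
  constant, and converge uniformly on the real line because \<open>u\<close> is uniformly continuous. By the maximum
  principle they converge uniformly on the closed half plane, and the limit is continuous.
\<close>

lemma half_plane_derivative_boundary_values:
  fixes F :: "complex \<Rightarrow> complex" and u :: "real \<Rightarrow> complex"
  assumes lip: "L-lipschitz_on {z. Im z \<le> 0} F"
    and hol: "F holomorphic_on {z. Im z < 0}"
    and der: "\<And>x. ((\<lambda>x. F (of_real x)) has_vector_derivative u x) (at x)"
    and uc: "uniformly_continuous_on UNIV u"
  shows "continuous_on {z. Im z \<le> 0} (\<lambda>z. if Im z < 0 then deriv F z else u (Re z))"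
    (is "continuous_on ?H ?G")
proof -
  define D where "D h z = (F (z + of_real h) - F z) / of_real h" for h z
  have contF: "continuous_on ?H F"
    using lip by (rule lipschitz_on_continuous_on)
  have contD: "continuous_on ?H (D h)" if "h > 0" for h
    unfolding D_def using that
    by (intro continuous_intros contF continuous_on_compose2[OF contF]) auto
  have holD: "D h holomorphic_on {z. Im z < 0}" if "h > 0" for h
  proof -
    have "F \<circ> (\<lambda>z. z + of_real h) holomorphic_on {z. Im z < 0}"
      by (rule holomorphic_on_compose_gen[OF _ hol]) (auto intro!: holomorphic_intros)
    then show ?thesis
      unfolding D_def comp_def using that by (intro holomorphic_intros hol) auto
  qed
  have bdD: "cmod (D h z) \<le> L" if "h > 0" "Im z \<le> 0" for h z
    using lipschitz_onD[OF lip, of "z + of_real h" z] that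
    by (simp add: D_def norm_divide dist_norm divide_le_eq)
  have "uniform_limit ?H D ?G (at_right 0)"
  proof (rule uniform_limitI)
    fix e :: real assume e: "e > 0"
    obtain d where d: "d > 0" "\<And>x y. dist y x < d \<Longrightarrow> dist (u y) (u x) < e / 4"
      using uc e unfolding uniformly_continuous_on_def by (metis UNIV_I zero_less_divide_iff zero_less_numeral)
    have bdry: "cmod (D h (of_real x) - u x) \<le> e / 4" if h: "0 < h" "h < d" for h x
    proof -
      have "cmod (F (of_real (x + h)) - F (of_real x) - (x + h - x) *\<^sub>R u x) \<le> norm (x + h - x) * (e / 4)"
      proof (rule vector_differentiable_bound_linearization[where S = "{x..x+h}"])
        show "((\<lambda>x. F (of_real x)) has_vector_derivative u t) (at t within {x..x+h})" for t
          using der by (rule has_vector_derivative_at_within)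
        show "cmod (u t - u x) \<le> e / 4" if "t \<in> {x..x+h}" for t
          using d(2)[of t x] that h by (simp add: dist_norm)
      qed (use h in \<open>auto simp: closed_segment_eq_real_ivl\<close>)
      moreover have "D h (of_real x) - u x = (F (of_real (x + h)) - F (of_real x) - h *\<^sub>R u x) / of_real h"
        using h by (simp add: D_def field_simps scaleR_conv_of_real)
      ultimately show ?thesis
        using h by (simp add: norm_divide divide_le_eq mult.commute)
    qed
    have inner: "cmod (D h z - D k z) \<le> e / 2" if h: "0 < h" "h < d" and k: "0 < k" "k < d" and z: "Im z < 0" for h k z
    proof (rule half_plane_bounded_max_modulus[where f = "\<lambda>z. D h z - D k z" and M = "2 * L"])
      show "cmod (D h w - D k w) \<le> 2 * L" if "Im w < 0" for w
        using norm_triangle_ineq4[of "D h w" "D k w"] bdD[of h w] bdD[of k w] that h k by simp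
      show "cmod (D h (of_real x) - D k (of_real x)) \<le> e / 2" for x
        using norm_triangle_ineq4[of "D h (of_real x) - u x" "D k (of_real x) - u x"]
          bdry[OF h, of x] bdry[OF k, of x] by simp
    qed (use h k z in \<open>auto intro!: continuous_intros contD holomorphic_intros holD\<close>)
    have lim: "((\<lambda>k. D k z) \<longlongrightarrow> deriv F z) (at_right 0)" if z: "Im z < 0" for z
    proof -
      have "(F has_field_derivative deriv F z) (at z)"
        using z by (intro holomorphic_derivI[OF hol]) (auto simp: open_halfspace_Im_lt)
      then have "((\<lambda>k. (F (z + k) - F z) / k) \<longlongrightarrow> deriv F z) (at 0)"
        by (simp add: DERIV_def)
      moreover have "filterlim complex_of_real (at 0) (at_right 0)"
        by (auto simp: filterlim_at eventually_at_filter intro!: tendsto_eq_intros)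
      ultimately show ?thesis
        unfolding D_def by (rule filterlim_compose)
    qed
    have "\<forall>\<^sub>F h in at_right 0. 0 < h \<and> h < d"
      using d(1) eventually_at_right_less by (auto simp: eventually_at_right_field)
    then show "\<forall>\<^sub>F h in at_right 0. \<forall>z\<in>?H. dist (D h z) (?G z) < e"
    proof eventually_elim
      case (elim h)
      show ?case
      proof
        fix z assume z: "z \<in> ?H"
        show "dist (D h z) (?G z) < e"
        proof (cases "Im z < 0")
          case True
          have "((\<lambda>k. cmod (D h z - D k z)) \<longlongrightarrow> cmod (D h z - deriv F z)) (at_right 0)"
            by (intro tendsto_intros lim True)
          moreover have "\<forall>\<^sub>F k in at_right 0. cmod (D h z - D k z) \<le> e / 2"
            unfolding eventually_at_right_field using d(1) elim True
            by (intro exI[of _ d]) (blast intro: inner)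
          ultimately have "cmod (D h z - deriv F z) \<le> e / 2"
            by (rule tendsto_upperbound) simp
          then show ?thesis using True e by (simp add: dist_norm)
        next
          case False
          then have "z = of_real (Re z)" using z by (simp add: complex_eq_iff)
          then have "cmod (D h z - u (Re z)) \<le> e / 4"
            using bdry[of h "Re z"] elim by metis
          then show ?thesis using False e by (simp add: dist_norm)
        qed
      qed
    qed
  qed
  moreover have "\<forall>\<^sub>F h in at_right 0. continuous_on ?H (D h)"
    using contD by (auto simp: eventually_at_filter)
  ultimately show ?thesis
    using uniform_limit_theorem by (metis trivial_limit_at_right_real)
qed

text \<open>
  Multiplication by \<open>z / (z - \<i> A)\<close> with \<open>A\<close> large makes \<open>f\<close> small on the bounded part of the real
  line where it is not small already, without enlarging it elsewhere. The maximum principle makes the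
  product small everywhere, and far out the factor is bounded below.
\<close>

lemma half_plane_decay:
  fixes f :: "complex \<Rightarrow> complex"
  assumes cont: "continuous_on {z. Im z \<le> 0} f"
    and hol: "f holomorphic_on {z. Im z < 0}"
    and bdd: "\<And>z. Im z \<le> 0 \<Longrightarrow> cmod (f z) \<le> M"
    and lim: "((\<lambda>x::real. f (of_real x)) \<longlongrightarrow> 0) at_infinity"
    and e: "e > 0"
  shows "\<exists>R. \<forall>z. Im z \<le> 0 \<longrightarrow> R \<le> cmod z \<longrightarrow> cmod (f z) \<le> e"
proof -
  have M0: "0 \<le> M" using order_trans[OF norm_ge_zero bdd[of 0]] by simp
  obtain R0 where R0: "\<And>x::real. R0 \<le> \<bar>x\<bar> \<Longrightarrow> cmod (f (of_real x)) < e / 2"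
    using tendstoD[OF lim, of "e/2"] e by (auto simp: eventually_at_infinity)
  define R where "R = max R0 1"
  \<comment> \<open>large enough for \<open>M * (R / A) \<le> e / 2\<close>, the bound needed on \<open>[-R, R]\<close>\<close>
  define A where "A = R * (2 * M / e + 1)"
  have R: "R \<ge> 1" "R \<ge> R0" by (auto simp: R_def)
  have A: "A \<ge> R" "R * M / A \<le> e / 2"
  proof -
    have "R * 1 \<le> A" unfolding A_def using R M0 e by (intro mult_left_mono) auto
    then show "A \<ge> R" by simp
    have "R * M \<le> e / 2 * A" unfolding A_def using R e by (simp add: field_simps)
    then show "R * M / A \<le> e / 2" using \<open>A \<ge> R\<close> R by (simp add: divide_le_eq)
  qed
  have A0: "A > 0" using A R by linarith
  let ?d = "\<lambda>z. z - \<i> * of_real A"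
  have dIm: "cmod (?d z) \<ge> A - Im z" if "Im z \<le> 0" for z
    using abs_Im_le_cmod[of "?d z"] that A0 by simp
  have ne: "?d z \<noteq> 0" if "Im z \<le> 0" for z
    using dIm[OF that] that A0 by auto
  have dz: "cmod z \<le> cmod (?d z)" if "Im z \<le> 0" for z
  proof -
    have "(cmod z)\<^sup>2 \<le> (cmod (?d z))\<^sup>2"
      unfolding cmod_power2 using that A0 mult_nonneg_nonneg[of "-Im z" A]
      by (auto simp: power2_eq_square algebra_simps)
    then show ?thesis by (rule power2_le_imp_le) simp
  qed
  let ?g = "\<lambda>z. f z * (z / ?d z)"
  have fr: "cmod (z / ?d z) \<le> 1" if "Im z \<le> 0" for z
    using dz[OF that] ne[OF that] by (simp add: norm_divide divide_le_eq)
  have g: "cmod (?g z) \<le> e / 2" if z: "Im z < 0" for z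
  proof (rule half_plane_bounded_max_modulus[where f = ?g and M = M])
    show "cmod (?g z) \<le> M" if "Im z < 0" for z
      unfolding norm_mult using mult_mono[OF bdd fr, of z z] that M0 by simp
    show "cmod (?g (of_real x)) \<le> e / 2" for x
    proof (cases "\<bar>x\<bar> \<ge> R")
      case True
      then have "cmod (f (of_real x)) \<le> e / 2" using R0[of x] R by simp
      then have "cmod (f (of_real x)) * cmod (of_real x / ?d (of_real x)) \<le> e / 2 * 1"
        using fr[of "of_real x"] e by (intro mult_mono) auto
      then show ?thesis by (simp only: norm_mult mult_1_right)
    next
      case False
      have "cmod (of_real x / ?d (of_real x)) \<le> R / A"
        unfolding norm_divide using False dIm[of "of_real x"] A0 R by (intro frac_le) auto
      then have "cmod (?g (of_real x)) \<le> M * (R / A)"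
        unfolding norm_mult using bdd[of "of_real x"] M0 by (intro mult_mono) auto
      also have "M * (R / A) = R * M / A" by simp
      finally show ?thesis using A(2) by (rule order_trans)
    qed
    show "continuous_on {z. Im z \<le> 0} ?g"
      using ne by (intro continuous_intros cont) auto
    show "?g holomorphic_on {z. Im z < 0}"
      using ne by (intro holomorphic_intros hol) auto
  qed (rule z)
  have "cmod (f z) \<le> e" if z: "Im z \<le> 0" "A \<le> cmod z" for z
  proof (cases "Im z = 0")
    case True
    then have "z = of_real (Re z)" by (simp add: complex_eq_iff)
    then have "cmod (f z) < e / 2"
      using R0[of "Re z"] z A R by (metis norm_of_real order_trans)
    then show ?thesis using e by simp
  next
    case False
    have "cmod (?d z) \<le> cmod z + A"
      using norm_triangle_ineq4[of z "\<i> * of_real A"] A0 by (simp add: norm_mult)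
    then have dd: "cmod (?d z) \<le> 2 * cmod z" using z by simp
    have "cmod (f z) * cmod z \<le> e / 2 * cmod (?d z)"
      using g[of z] False z ne[of z] by (simp add: norm_mult norm_divide divide_le_eq)
    also have "\<dots> \<le> e / 2 * (2 * cmod z)"
      using dd e by (intro mult_left_mono) auto
    finally have "cmod (f z) * cmod z \<le> e * cmod z" by simp
    then show ?thesis using z A0 by (auto simp: mult_le_cancel_right)
  qed
  then show ?thesis by blast
qed

text \<open>
  This is the maximum principle for \<open>1 / f\<close>. The lower bound \<open>m\<close> near infinity, together with
  compactness, supplies the crude bound on \<open>1 / f\<close> without which functions such as \<open>exp (- \<i> z)\<close> would
  be counterexamples.
\<close>

lemma half_plane_min_modulus:
  fixes f :: "complex \<Rightarrow> complex"
  assumes cont: "continuous_on {z. Im z \<le> 0} f"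
    and hol: "f holomorphic_on {z. Im z < 0}"
    and ne: "\<And>z. Im z < 0 \<Longrightarrow> f z \<noteq> 0"
    and bdry: "\<And>x::real. \<delta> \<le> cmod (f (of_real x))" and \<delta>: "\<delta> > 0"
    and far: "\<And>z. Im z \<le> 0 \<Longrightarrow> R \<le> cmod z \<Longrightarrow> m \<le> cmod (f z)" and m: "m > 0"
    and z: "Im z \<le> 0"
  shows "\<delta> \<le> cmod (f z)"
proof (cases "Im z = 0")
  case True
  then have "z = of_real (Re z)" by (simp add: complex_eq_iff)
  then show ?thesis using bdry by metis
next
  case False
  have ne': "f w \<noteq> 0" if "Im w \<le> 0" for w
  proof (cases "Im w = 0")
    case True
    then have "w = of_real (Re w)" by (simp add: complex_eq_iff)
    then have "\<delta> \<le> cmod (f w)" using bdry by metis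
    then show ?thesis using \<delta> by auto
  qed (use ne that in auto)
  have ci: "continuous_on {z. Im z \<le> 0} (\<lambda>z. inverse (f z))"
    using ne' by (intro continuous_intros cont) auto
  have "compact ({z. Im z \<le> 0} \<inter> cball 0 R)"
    by (intro closed_Int_compact closed_halfspace_Im_le) auto
  then have "compact ((\<lambda>z. inverse (f z)) ` ({z. Im z \<le> 0} \<inter> cball 0 R))"
    by (intro compact_continuous_image continuous_on_subset[OF ci]) auto
  then obtain M where M: "\<And>w. Im w \<le> 0 \<Longrightarrow> cmod w \<le> R \<Longrightarrow> cmod (inverse (f w)) \<le> M"
    using bounded_iff[THEN iffD1, OF compact_imp_bounded] by force
  have "cmod (inverse (f z)) \<le> inverse \<delta>"
  proof (rule half_plane_bounded_max_modulus[OF ci])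
    show "(\<lambda>z. inverse (f z)) holomorphic_on {z. Im z < 0}"
      using ne by (intro holomorphic_intros hol) auto
    show "cmod (inverse (f w)) \<le> max M (inverse m)" if "Im w < 0" for w
    proof (cases "cmod w \<le> R")
      case True
      then show ?thesis using M[of w] that by simp
    next
      case False
      then have "cmod (inverse (f w)) \<le> inverse m"
        unfolding norm_inverse using far[of w] m that by (intro le_imp_inverse_le) auto
      then show ?thesis by simp
    qed
    show "cmod (inverse (f (of_real x))) \<le> inverse \<delta>" for x
      unfolding norm_inverse using bdry[of x] \<delta> by (intro le_imp_inverse_le)
    show "Im z < 0" using z False by simp
  qed
  then show ?thesis
    unfolding norm_inverse using \<delta> ne'[OF z] by (simp add: inverse_le_iff)
qed

text \<open>
  A bounded derivative makes the primitive Lipschitz, hence extendable to the closed half plane;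
  continuity of \<open>f\<close> at a boundary point then gives the derivative of the extension along the real
  line.
\<close>

lemma half_plane_primitive:
  fixes f :: "complex \<Rightarrow> complex"
  assumes cont: "continuous_on {z. Im z \<le> 0} f"
    and hol: "f holomorphic_on {z. Im z < 0}"
    and bdd: "\<And>z. Im z < 0 \<Longrightarrow> cmod (f z) \<le> M"
  obtains \<Phi> where "continuous_on {z. Im z \<le> 0} \<Phi>"
    and "\<And>z. Im z < 0 \<Longrightarrow> (\<Phi> has_field_derivative f z) (at z)"
    and "\<And>x. ((\<lambda>x. \<Phi> (of_real x)) has_vector_derivative f (of_real x)) (at x)"
proof -
  have M0: "0 \<le> M" using order_trans[OF norm_ge_zero bdd[of "-\<i>"]] by simp
  obtain P where P: "\<And>z. z \<in> {z. Im z < 0} \<Longrightarrow> (P has_field_derivative f z) (at z within {z. Im z < 0})"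
    using holomorphic_convex_primitive'[OF convex_halfspace_Im_lt open_halfspace_Im_lt hol] by blast
  have "M-lipschitz_on {z. Im z < 0} P"
  proof (rule lipschitz_onI)
    show "dist (P x) (P y) \<le> M * dist x y" if "x \<in> {z. Im z < 0}" "y \<in> {z. Im z < 0}" for x y
      unfolding dist_norm
      by (rule field_differentiable_bound[OF convex_halfspace_Im_lt P]) (use that bdd in auto)
  qed (rule M0)
  then obtain \<Phi> where lip: "M-lipschitz_on (closure {z. Im z < 0}) \<Phi>"
    and \<Phi>: "\<And>z. Im z < 0 \<Longrightarrow> \<Phi> z = P z"
    using lipschitz_extend_closure by (metis mem_Collect_eq)
  have cl: "closure {z. Im z < 0} = {z. Im z \<le> 0}"
  proof -
    have "closure {z. \<i> \<bullet> z < 0} = {z. \<i> \<bullet> z \<le> 0}"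
      by (rule closure_halfspace_lt) simp
    then show ?thesis by (simp add: inner_complex_def)
  qed
  have c: "continuous_on {z. Im z \<le> 0} \<Phi>"
    using lipschitz_on_continuous_on[OF lip] cl by simp
  have d: "(\<Phi> has_field_derivative f z) (at z)" if "Im z < 0" for z
  proof (rule has_field_derivative_transform_within_open[where S = "{z. Im z < 0}"])
    show "(P has_field_derivative f z) (at z)"
      using P[of z] that by (simp add: at_within_open[OF _ open_halfspace_Im_lt])
  qed (use that \<Phi> in \<open>auto simp: open_halfspace_Im_lt\<close>)
  have "((\<lambda>x. \<Phi> (of_real x)) has_vector_derivative f (of_real x)) (at x)" for x :: real
    unfolding has_vector_derivative_def has_derivative_at_alt
  proof (intro conjI allI impI)
    show "bounded_linear (\<lambda>h. h *\<^sub>R f (of_real x))"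
      by (rule bounded_linear_scaleR_left)
    fix e :: real assume e: "e > 0"
    obtain d' where d': "d' > 0" "\<And>z. Im z \<le> 0 \<Longrightarrow> dist z (of_real x) < d' \<Longrightarrow> dist (f z) (f (of_real x)) < e"
      using cont e unfolding continuous_on_iff by (metis Im_complex_of_real mem_Collect_eq order_refl)
    have "cmod (\<Phi> (of_real y) - \<Phi> (of_real x) - (y - x) *\<^sub>R f (of_real x)) \<le> e * norm (y - x)"
      if "norm (y - x) < d'" for y
    proof -
      have "cmod (\<Phi> (of_real y) - \<Phi> (of_real x) - f (of_real x) * (of_real y - of_real x))
          \<le> e * cmod (of_real y - of_real x)"
      proof (rule half_plane_mean_value[OF c d, where S = "ball (of_real x) d'"])
        show "cmod (f z - f (of_real x)) \<le> e" if "z \<in> ball (of_real x) d'" "Im z < 0" for z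
          using d'(2)[of z] that by (simp add: dist_norm norm_minus_commute less_imp_le)
        show "complex_of_real y \<in> ball (of_real x) d'"
          using that by (simp add: dist_of_real dist_real_def abs_minus_commute)
      qed (use d'(1) in auto)
      then show ?thesis
        by (simp add: scaleR_conv_of_real mult.commute flip: of_real_diff)
    qed
    then show "\<exists>d>0. \<forall>y. norm (y - x) < d \<longrightarrow>
        cmod (\<Phi> (of_real y) - \<Phi> (of_real x) - (y - x) *\<^sub>R f (of_real x)) \<le> e * norm (y - x)"
      using d'(1) by blast
  qed
  then show ?thesis using that c d by blast
qed

section \<open>Positive harmonic functions that dominate a square\<close>

text \<open>
  The Schwarz lemma for the Cayley transform of \<open>f\<close>, which maps the upper half plane to the unit disc
  and \<open>f a\<close> to 0. Adding \<open>\<i> e\<close> to \<open>f\<close> makes the imaginary part strictly positive.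
\<close>

lemma Schwarz_Pick_centre:
  assumes hol: "f holomorphic_on ball a r" and r: "r > 0"
    and pos: "\<And>z. z \<in> ball a r \<Longrightarrow> 0 \<le> Im (f z)"
  shows "cmod (deriv f a) \<le> 2 * Im (f a) / r"
proof -
  have main: "cmod (deriv f a) \<le> 2 * (Im (f a) + e) / r" if e: "e > 0" for e
  proof -
    define b where "b = f a + \<i> * of_real e"
    define h where "h \<zeta> = f (a + of_real r * \<zeta>) + \<i> * of_real e" for \<zeta>
    define m where "m \<zeta> = (h \<zeta> - b) / (h \<zeta> - cnj b)" for \<zeta>
    have inb: "a + of_real r * \<zeta> \<in> ball a r" if "cmod \<zeta> < 1" for \<zeta>
      using that r by (simp add: dist_norm norm_mult)
    have Imh: "Im (h \<zeta>) > 0" if "cmod \<zeta> < 1" for \<zeta>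
      using pos[OF inb[OF that]] e by (simp add: h_def)
    have Imb: "Im b > 0"
      using Imh[of 0] by (simp add: h_def b_def)
    have ne: "h \<zeta> - cnj b \<noteq> 0" if "cmod \<zeta> < 1" for \<zeta>
      using Imh[OF that] Imb by (auto simp: complex_eq_iff)
    have holh: "h holomorphic_on ball 0 1"
    proof -
      have "f \<circ> (\<lambda>\<zeta>. a + of_real r * \<zeta>) holomorphic_on ball 0 1"
        by (rule holomorphic_on_compose_gen[OF _ hol]) (use inb in \<open>auto intro!: holomorphic_intros\<close>)
      then show ?thesis
        unfolding h_def comp_def by (intro holomorphic_intros)
    qed
    have holm: "m holomorphic_on ball 0 1"
      unfolding m_def using ne by (intro holomorphic_intros holh) auto
    have m1: "cmod (m \<zeta>) < 1" if "cmod \<zeta> < 1" for \<zeta>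
    proof -
      have "(cmod (h \<zeta> - b))\<^sup>2 < (cmod (h \<zeta> - cnj b))\<^sup>2"
        unfolding cmod_power2 using mult_pos_pos[OF Imh[OF that] Imb]
        by (simp add: power2_eq_square algebra_simps)
      then have "cmod (h \<zeta> - b) < cmod (h \<zeta> - cnj b)"
        by (rule power_less_imp_less_base) simp
      then show ?thesis
        using ne[OF that] by (simp add: m_def norm_divide divide_less_eq)
    qed
    have m0: "m 0 = 0" by (simp add: m_def h_def b_def)
    have dm: "cmod (deriv m 0) \<le> 1"
      by (rule Schwarz_Lemma(2)[OF holm m0 m1, of 0]) auto
    have df: "(f has_field_derivative deriv f a) (at a)"
      using hol r by (intro holomorphic_derivI[of f "ball a r"]) auto
    have dh: "(h has_field_derivative deriv f a * of_real r) (at 0)"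
      unfolding h_def
      by (rule derivative_eq_intros DERIV_chain2[where f = f and g = "\<lambda>\<zeta>. a + of_real r * \<zeta>" and x = 0] refl | use df in simp)+
    have h0: "h 0 = b" by (simp add: h_def b_def)
    have "(m has_field_derivative (deriv f a * of_real r) / (b - cnj b)) (at 0)"
    proof -
      have bn: "b - cnj b \<noteq> 0" using ne[of 0] h0 by simp
      have "(m has_field_derivative
          (deriv f a * of_real r * (h 0 - cnj b) - (h 0 - b) * (deriv f a * of_real r))
            / ((h 0 - cnj b) * (h 0 - cnj b))) (at 0)"
        unfolding m_def using bn h0
          DERIV_divide[OF DERIV_diff[OF dh DERIV_const, of b] DERIV_diff[OF dh DERIV_const, of "cnj b"]]
        by simp
      then show ?thesis using bn by (simp add: h0)
    qed
    then have "deriv m 0 = (deriv f a * of_real r) / (b - cnj b)"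
      by (rule DERIV_imp_deriv)
    also have "b - cnj b = 2 * \<i> * of_real (Im b)"
      by (simp add: complex_eq_iff)
    finally have "cmod (deriv f a) * r / (2 * Im b) \<le> 1"
      using dm r Imb by (simp add: norm_divide norm_mult)
    then show ?thesis
      using r Imb by (simp add: field_simps b_def)
  qed
  have "((\<lambda>e. 2 * (Im (f a) + e) / r) \<longlongrightarrow> 2 * (Im (f a) + 0) / r) (at_right 0)"
    using r by (intro tendsto_intros) auto
  moreover have "\<forall>\<^sub>F e in at_right 0. cmod (deriv f a) \<le> 2 * (Im (f a) + e) / r"
    using main by (auto simp: eventually_at_filter)
  ultimately have "cmod (deriv f a) \<le> 2 * (Im (f a) + 0) / r"
    by (rule tendsto_lowerbound) simp
  then show ?thesis by simp
qed

text \<open>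
  The coefficient \<open>C / t\<^sup>2\<close> has the bounded antiderivative \<open>- C / t\<close> near infinity, so the integrating
  factor \<open>exp (- C / t)\<close> turns \<open>p\<close> into a nondecreasing function with the same limit.
\<close>

lemma inverse_square_Gronwall:
  fixes p p' :: "real \<Rightarrow> real"
  assumes der: "\<And>t. t > 0 \<Longrightarrow> (p has_real_derivative p' t) (at t)"
    and bd: "\<And>t. t > 0 \<Longrightarrow> - p' t \<le> C * p t / t\<^sup>2"
    and lim: "(p \<longlongrightarrow> 0) at_top"
    and s: "s > 0"
  shows "p s \<le> 0"
proof -
  let ?q = "\<lambda>t. p t * exp (- C / t)"
  have "?q s \<le> ?q t" if "s \<le> t" for t
  proof (rule DERIV_nonneg_imp_nondecreasing[OF that])
    fix r assume r: "s \<le> r" "r \<le> t"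
    then have r0: "r > 0" using s by simp
    have "(?q has_real_derivative (p' r + C * p r / r\<^sup>2) * exp (- C / r)) (at r)"
      using r0 by (auto intro!: derivative_eq_intros der simp: field_simps power2_eq_square)
    moreover have "0 \<le> (p' r + C * p r / r\<^sup>2) * exp (- C / r)"
      using bd[OF r0] by simp
    ultimately show "\<exists>y. (?q has_real_derivative y) (at r) \<and> 0 \<le> y" by blast
  qed
  then have "\<forall>\<^sub>F t in at_top. ?q s \<le> ?q t"
    using eventually_ge_at_top by (rule eventually_mono[rotated])
  moreover have "(?q \<longlongrightarrow> 0 * exp 0) at_top"
    by (intro tendsto_intros lim filterlim_compose[OF tendsto_exp] tendsto_divide_0[OF tendsto_const] filterlim_at_top_imp_at_infinity filterlim_ident)
  ultimately have "?q s \<le> 0 * exp 0"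
    by (intro tendsto_lowerbound[of ?q]) auto
  then show ?thesis by (simp add: mult_le_0_iff)
qed

text \<open>
  The comparison function is \<open>e + Im (B / (z - \<i> R))\<close>: a small constant, which dominates the boundary
  values outside \<open>[-R, R]\<close>, plus a multiple of a Poisson kernel with pole at \<open>\<i> R\<close>, which dominates
  them inside and is \<open>O(1 / t)\<close> at depth \<open>t\<close>.
\<close>

lemma half_plane_Im_vanishing_along_columns:
  fixes \<Phi> K :: "complex \<Rightarrow> complex"
  assumes cont: "continuous_on {z. Im z \<le> 0} \<Phi>"
    and der: "\<And>z. Im z < 0 \<Longrightarrow> (\<Phi> has_field_derivative K z) (at z)"
    and bd: "\<And>z. Im z < 0 \<Longrightarrow> cmod (K z) \<le> M"
    and decay: "\<And>\<eta>. \<eta> > 0 \<Longrightarrow> \<exists>R. \<forall>z. Im z < 0 \<longrightarrow> R \<le> cmod z \<longrightarrow> cmod (K z) \<le> \<eta>"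
    and nonneg: "\<And>z. Im z \<le> 0 \<Longrightarrow> 0 \<le> Im (\<Phi> z)"
    and bdry: "((\<lambda>x::real. Im (\<Phi> (of_real x))) \<longlongrightarrow> 0) at_infinity"
  shows "((\<lambda>t. Im (\<Phi> (Complex a (- t)))) \<longlongrightarrow> 0) at_top"
proof -
  have contR: "continuous_on UNIV (\<lambda>x::real. Im (\<Phi> (of_real x)))"
    by (intro continuous_intros continuous_on_compose2[OF cont]) auto
  have upper: "\<exists>B\<ge>0. \<forall>t>0. Im (\<Phi> (Complex a (- t))) \<le> e + B / t" if e: "e > 0" for e
  proof -
    obtain R0 where R0: "\<And>x::real. R0 \<le> \<bar>x\<bar> \<Longrightarrow> Im (\<Phi> (of_real x)) < e"
      using order_tendstoD(2)[OF bdry e] by (auto simp: eventually_at_infinity)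
    define R where "R = max R0 1"
    have R: "R \<ge> 1" "R \<ge> R0" by (auto simp: R_def)
    have "compact ((\<lambda>x::real. Im (\<Phi> (of_real x))) ` {-R..R})"
      by (intro compact_continuous_image continuous_on_subset[OF contR]) auto
    then obtain S where S: "\<And>x. x \<in> {-R..R} \<Longrightarrow> \<bar>Im (\<Phi> (of_real x))\<bar> \<le> S"
      using bounded_iff[THEN iffD1, OF compact_imp_bounded] by force
    have S0: "0 \<le> S" using S[of 0] R by auto
    \<comment> \<open>on \<open>[-R, R]\<close> the Poisson kernel \<open>R / (x\<^sup>2 + R\<^sup>2)\<close> is at least \<open>1 / (2 R)\<close>\<close>
    define B where "B = 2 * R * S"
    have B0: "0 \<le> B" using R S0 by (simp add: B_def)
    let ?d = "\<lambda>z. z - \<i> * of_real R"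
    have d1: "1 \<le> cmod (?d z)" if "Im z \<le> 0" for z
      using abs_Im_le_cmod[of "?d z"] that R by simp
    have ne: "?d z \<noteq> 0" if "Im z \<le> 0" for z
      using d1[OF that] by auto
    let ?f = "\<lambda>z. \<Phi> z - \<i> * of_real e - of_real B / ?d z"
    let ?f' = "\<lambda>z. K z + of_real B / (?d z)\<^sup>2"
    have kernel: "cmod (of_real B / (?d z)\<^sup>2) \<le> B / cmod (?d z)" if "Im z \<le> 0" for z
    proof -
      have "cmod (?d z) * 1 \<le> cmod (?d z) * cmod (?d z)"
        using d1[OF that] by (intro mult_left_mono) auto
      moreover have "0 < cmod (?d z)" using d1[OF that] by linarith
      ultimately show ?thesis
        unfolding norm_divide norm_power power2_eq_square using B0
        by (simp only: norm_of_real abs_of_nonneg mult_1_right norm_mult) (intro divide_left_mono mult_pos_pos)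
    qed
    have main: "Im (?f z) \<le> 0" if z: "Im z \<le> 0" for z
    proof (rule half_plane_max_principle_Im[where f = ?f and f' = ?f' and M = "M + B"])
      show "continuous_on {z. Im z \<le> 0} ?f"
        using ne by (intro continuous_intros cont) auto
      show "(?f has_field_derivative ?f' w) (at w)" if "Im w < 0" for w
        using ne[of w] that
        by (auto intro!: derivative_eq_intros der simp: field_simps power2_eq_square)
      show "cmod (?f' w) \<le> M + B" if w: "Im w < 0" for w
      proof -
        have "B / cmod (?d w) \<le> B / 1"
          using B0 d1[of w] w by (intro divide_left_mono) auto
        then show ?thesis
          using norm_triangle_ineq[of "K w" "of_real B / (?d w)\<^sup>2"] kernel[of w] bd[OF w] w by simp
      qed
      show "\<exists>R. \<forall>z. Im z < 0 \<longrightarrow> R \<le> cmod z \<longrightarrow> cmod (?f' z) \<le> \<eta>" if \<eta>: "\<eta> > 0" for \<eta>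
      proof -
        obtain R1 where R1: "\<And>z. Im z < 0 \<Longrightarrow> R1 \<le> cmod z \<Longrightarrow> cmod (K z) \<le> \<eta> / 2"
          using decay[of "\<eta> / 2"] \<eta> by auto
        have "cmod (?f' w) \<le> \<eta>" if w: "Im w < 0" "max R1 (R + 2 * B / \<eta>) \<le> cmod w" for w
        proof -
          have "cmod (?d w) \<ge> cmod w - R"
            using norm_triangle_ineq2[of w "\<i> * of_real R"] R by (simp add: norm_mult)
          then have "2 * B / \<eta> \<le> cmod (?d w)" using w by simp
          then have "2 * B \<le> cmod (?d w) * \<eta>" using \<eta> by (simp add: divide_le_eq)
          then have "B / cmod (?d w) \<le> \<eta> / 2"
            using d1[of w] w \<eta> by (simp add: divide_le_eq mult.commute)
          then show ?thesis
            using norm_triangle_ineq[of "K w" "of_real B / (?d w)\<^sup>2"] kernel[OF less_imp_le[OF w(1)]]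
              R1[OF w(1) order_trans[OF max.cobounded1 w(2)]] by linarith
        qed
        then show ?thesis by blast
      qed
      show "Im (?f (of_real x)) \<le> 0" for x
      proof -
        have eq: "Im (?f (of_real x)) = Im (\<Phi> (of_real x)) - e - B * R / (x\<^sup>2 + R\<^sup>2)"
          using R by (simp add: Im_divide power2_eq_square)
        show ?thesis
        proof (cases "\<bar>x\<bar> \<ge> R")
          case True
          then have "Im (\<Phi> (of_real x)) < e" using R0[of x] R by simp
          moreover have "0 \<le> B * R / (x\<^sup>2 + R\<^sup>2)" using B0 R by simp
          ultimately show ?thesis unfolding eq by linarith
        next
          case False
          then have "x\<^sup>2 \<le> R\<^sup>2" using abs_le_square_iff[of x R] R by simp
          then have "S * (x\<^sup>2 + R\<^sup>2) \<le> S * (2 * R\<^sup>2)"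
            using S0 by (intro mult_left_mono) auto
          then have "S \<le> B * R / (x\<^sup>2 + R\<^sup>2)"
            using R by (simp add: B_def pos_le_divide_eq add_nonneg_pos power2_eq_square mult_ac)
          moreover have "x \<in> {-R..R}" using False by auto
          then have "Im (\<Phi> (of_real x)) \<le> S" using S abs_le_D1 by blast
          ultimately show ?thesis unfolding eq using e by linarith
        qed
      qed
    qed (rule z)
    have "Im (\<Phi> (Complex a (- t))) \<le> e + B / t" if t: "t > 0" for t
    proof -
      let ?z = "Complex a (- t)"
      have "Im (of_real B / ?d ?z) \<le> cmod (of_real B / ?d ?z)"
        using abs_Im_le_cmod abs_le_D1 by blast
      also have "\<dots> = B / cmod (?d ?z)" using B0 by (simp add: norm_divide)
      also have "\<dots> \<le> B / t"
        using abs_Im_le_cmod[of "?d ?z"] B0 t R by (intro divide_left_mono mult_pos_pos) auto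
      finally show ?thesis using main[of ?z] t by simp
    qed
    then show ?thesis using B0 by blast
  qed
  show ?thesis
  proof (rule tendstoI)
    fix e :: real assume e: "e > 0"
    obtain B where B: "\<And>t. t > 0 \<Longrightarrow> Im (\<Phi> (Complex a (- t))) \<le> e / 2 + B / t"
      using upper[of "e / 2"] e by auto
    have "((\<lambda>t. B / t) \<longlongrightarrow> 0) at_top"
      by (intro tendsto_divide_0[OF tendsto_const] filterlim_at_top_imp_at_infinity filterlim_ident)
    then have "\<forall>\<^sub>F t in at_top. B / t < e / 2"
      using e by (intro order_tendstoD(2)) auto
    then show "\<forall>\<^sub>F t in at_top. dist (Im (\<Phi> (Complex a (- t)))) 0 < e"
      using eventually_gt_at_top[of 0]
    proof eventually_elim
      case (elim t)
      then have "Im (\<Phi> (Complex a (- t))) < e" using B[of t] by linarith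
      then show ?case using elim nonneg[of "Complex a (- t)"] by simp
    qed
  qed
qed

text \<open>
  The core of the argument. A harmonic function \<open>v = Im \<Phi>\<close> with boundary values
  \<open>(\<mu> / 2) (Im F)\<^sup>2\<close> dominates \<open>(\<mu> / 2) (Im F)\<^sup>2\<close> inside. This is used through the tangents of the
  parabola: \<open>v - \<mu> t Im F + \<mu> t\<^sup>2 / 2 \<ge> 0\<close> for all real \<open>t\<close>, where the left-hand side is the imaginary
  part of the holomorphic function \<open>?h t\<close>. The Schwarz--Pick estimate for \<open>?h t\<close> and \<open>?h (- t)\<close> at the
  centre of the disc that touches the real line eliminates the derivative \<open>K\<close> of \<open>\<Phi>\<close> and bounds \<open>G\<close>
  by \<open>v\<close>. As \<open>K\<close> is quadratic in \<open>G\<close>, the bound closes up to the differential inequality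
  \<open>- v' \<le> (8 C / \<mu>) v / t\<^sup>2\<close> in the depth \<open>t\<close>, and \<open>v\<close> vanishes by Gronwall.
\<close>

lemma half_plane_square_flux_imp_deriv_zero:
  fixes F G \<Phi> K :: "complex \<Rightarrow> complex"
  assumes contF: "continuous_on {z. Im z \<le> 0} F"
    and derF: "\<And>z. Im z < 0 \<Longrightarrow> (F has_field_derivative G z) (at z)"
    and bdG: "\<And>z. Im z < 0 \<Longrightarrow> cmod (G z) \<le> M"
    and decayG: "\<And>\<eta>. \<eta> > 0 \<Longrightarrow> \<exists>R. \<forall>z. Im z < 0 \<longrightarrow> R \<le> cmod z \<longrightarrow> cmod (G z) \<le> \<eta>"
    and cont\<Phi>: "continuous_on {z. Im z \<le> 0} \<Phi>"
    and der\<Phi>: "\<And>z. Im z < 0 \<Longrightarrow> (\<Phi> has_field_derivative K z) (at z)"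
    and KG: "\<And>z. Im z < 0 \<Longrightarrow> cmod (K z) \<le> C * (cmod (G z))\<^sup>2" and C: "0 \<le> C"
    and bdry: "\<And>x::real. Im (\<Phi> (of_real x)) = \<mu> / 2 * (Im (F (of_real x)))\<^sup>2" and mu: "\<mu> > 0"
    and lim: "((\<lambda>x::real. Im (F (of_real x))) \<longlongrightarrow> 0) at_infinity"
    and z: "Im z < 0"
  shows "G z = 0"
proof -
  have M0: "0 \<le> M" using order_trans[OF norm_ge_zero bdG[OF z]] .
  have KG': "cmod (K z) \<le> C * M * cmod (G z)" if "Im z < 0" for z
  proof -
    have "C * (cmod (G z))\<^sup>2 \<le> C * (M * cmod (G z))"
      unfolding power2_eq_square using C bdG[OF that] by (intro mult_left_mono mult_right_mono) auto
    then show ?thesis using KG[OF that] by (simp add: mult.assoc)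
  qed
  have decay': "\<exists>R. \<forall>z. Im z < 0 \<longrightarrow> R \<le> cmod z \<longrightarrow> cmod (H z) \<le> \<eta>"
    if \<eta>: "\<eta> > 0" and H: "\<And>z. Im z < 0 \<Longrightarrow> cmod (H z) \<le> D * cmod (G z)" and D: "0 \<le> D"
    for \<eta> D and H :: "complex \<Rightarrow> complex"
  proof -
    obtain R where R: "\<And>z. Im z < 0 \<Longrightarrow> R \<le> cmod z \<Longrightarrow> cmod (G z) \<le> \<eta> / (D + 1)"
      using decayG[of "\<eta> / (D + 1)"] \<eta> D by auto
    have "cmod (H z) \<le> \<eta>" if "Im z < 0" "R \<le> cmod z" for z
    proof -
      have "cmod (H z) \<le> D * cmod (G z)" by (rule H) fact
      also have "\<dots> \<le> (D + 1) * (\<eta> / (D + 1))"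
        using R[OF that] D by (intro mult_mono) auto
      finally show ?thesis using D by simp
    qed
    then show ?thesis by blast
  qed
  let ?h = "\<lambda>t z. \<Phi> z - of_real (\<mu> * t) * F z + \<i> * of_real (\<mu> * t\<^sup>2 / 2)"
  have h_der: "(?h t has_field_derivative K z - of_real (\<mu> * t) * G z) (at z)" if "Im z < 0" for t z
    using that by (auto intro!: derivative_eq_intros der\<Phi> derF)
  have h_bd: "cmod (K z - of_real (\<mu> * t) * G z) \<le> (C * M + \<mu> * \<bar>t\<bar>) * cmod (G z)" if "Im z < 0" for t z
    using norm_triangle_ineq4[of "K z" "of_real (\<mu> * t) * G z"] KG'[OF that] mu
    by (simp add: norm_mult abs_mult algebra_simps)
  have h_nonneg: "0 \<le> Im (?h t z)" if z: "Im z \<le> 0" for t z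
  proof -
    have D0: "0 \<le> C * M + \<mu> * \<bar>t\<bar>" using C M0 mu by simp
    have "Im (- ?h t z) \<le> 0"
    proof (rule half_plane_max_principle_Im[where f = "\<lambda>z. - ?h t z"
          and f' = "\<lambda>z. - (K z - of_real (\<mu> * t) * G z)" and M = "(C * M + \<mu> * \<bar>t\<bar>) * M"])
      show "continuous_on {z. Im z \<le> 0} (\<lambda>z. - ?h t z)"
        by (intro continuous_intros contF cont\<Phi>)
      show "((\<lambda>z. - ?h t z) has_field_derivative - (K w - of_real (\<mu> * t) * G w)) (at w)"
        if "Im w < 0" for w
        by (rule DERIV_minus[OF h_der[OF that]])
      show "cmod (- (K w - of_real (\<mu> * t) * G w)) \<le> (C * M + \<mu> * \<bar>t\<bar>) * M" if "Im w < 0" for w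
        unfolding norm_minus_cancel
        by (rule order_trans[OF h_bd[OF that] mult_left_mono[OF bdG[OF that] D0]])
      show "\<exists>R. \<forall>z. Im z < 0 \<longrightarrow> R \<le> cmod z \<longrightarrow> cmod (- (K z - of_real (\<mu> * t) * G z)) \<le> \<eta>"
        if "\<eta> > 0" for \<eta>
        unfolding norm_minus_cancel by (rule decay'[OF that h_bd D0])
      show "Im (- ?h t (of_real x)) \<le> 0" for x
      proof -
        have "Im (- ?h t (of_real x)) = - (\<mu> / 2 * (Im (F (of_real x)) - t)\<^sup>2)"
          by (simp add: bdry power2_eq_square algebra_simps)
        then show ?thesis using mu by simp
      qed
    qed (rule z)
    then show ?thesis by simp
  qed
  have \<Phi>_nonneg: "0 \<le> Im (\<Phi> z)" if "Im z \<le> 0" for z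
    using h_nonneg[OF that, of 0] by simp
  have grad: "\<mu> * (Im z)\<^sup>2 * (cmod (G z))\<^sup>2 \<le> 8 * Im (\<Phi> z)" if z: "Im z < 0" for z
  proof -
    define \<beta> where "\<beta> = - Im z"
    have \<beta>: "\<beta> > 0" using z by (simp add: \<beta>_def)
    have inH: "Im w < 0" if "w \<in> ball z \<beta>" for w
      using abs_Im_le_cmod[of "w - z"] that by (simp add: \<beta>_def dist_norm norm_minus_commute)
    have SP: "cmod (K z - of_real (\<mu> * t) * G z) \<le> 2 * Im (?h t z) / \<beta>" for t
    proof -
      have "?h t holomorphic_on ball z \<beta>"
        unfolding holomorphic_on_open[OF open_ball] using h_der inH by blast
      then have "cmod (deriv (?h t) z) \<le> 2 * Im (?h t z) / \<beta>"
        by (rule Schwarz_Pick_centre) (use \<beta> inH h_nonneg in \<open>auto intro: less_imp_le\<close>)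
      then show ?thesis using DERIV_imp_deriv[OF h_der[OF z]] by simp
    qed
    \<comment> \<open>this choice of \<open>t\<close> optimises the resulting bound\<close>
    define t where "t = \<beta> * cmod (G z) / 2"
    have t: "0 \<le> t" using \<beta> by (simp add: t_def)
    have "2 * (\<mu> * t * cmod (G z)) = cmod ((K z - of_real (\<mu> * (- t)) * G z) - (K z - of_real (\<mu> * t) * G z))"
    proof -
      have "(K z - of_real (\<mu> * (- t)) * G z) - (K z - of_real (\<mu> * t) * G z) = of_real (2 * \<mu> * t) * G z"
        by simp
      then show ?thesis
        using mu t by (simp only: norm_mult norm_of_real) simp
    qed
    also have "\<dots> \<le> 2 * Im (?h (- t) z) / \<beta> + 2 * Im (?h t z) / \<beta>"
      by (rule order_trans[OF norm_triangle_ineq4 add_mono[OF SP SP]])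
    also have "\<dots> = 2 * (2 * Im (\<Phi> z) + \<mu> * t\<^sup>2) / \<beta>"
      by (simp add: add_divide_distrib[symmetric] algebra_simps)
    finally have "2 * (\<mu> * t * cmod (G z)) * \<beta> \<le> 2 * (2 * Im (\<Phi> z) + \<mu> * t\<^sup>2)"
      using \<beta> by (simp add: pos_le_divide_eq)
    then have "\<mu> * \<beta>\<^sup>2 * (cmod (G z))\<^sup>2 \<le> 8 * Im (\<Phi> z)"
      by (simp add: t_def power2_eq_square algebra_simps)
    then show ?thesis by (simp add: \<beta>_def)
  qed
  have "Im (\<Phi> z) \<le> 0"
  proof -
    let ?p = "\<lambda>t. Im (\<Phi> (Complex (Re z) (- t)))"
    have "?p (- Im z) \<le> 0"
    proof (rule inverse_square_Gronwall[where p = ?p and C = "8 * C / \<mu>"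
          and p' = "\<lambda>t. Im (- \<i> * K (Complex (Re z) (- t)))"])
      fix t :: real assume t: "t > 0"
      let ?w = "Complex (Re z) (- t)"
      have line: "((\<lambda>t. Complex (Re z) (- t)) has_vector_derivative - \<i>) (at t)"
        unfolding Complex_eq by (auto intro!: derivative_eq_intros simp: has_vector_derivative_real_field)
      have "(\<Phi> has_field_derivative K ?w) (at ?w)" using t by (intro der\<Phi>) simp
      then have "((\<Phi> \<circ> (\<lambda>t. Complex (Re z) (- t))) has_vector_derivative - \<i> * K ?w) (at t)"
        by (intro field_vector_diff_chain_at line)
      then show "(?p has_real_derivative Im (- \<i> * K ?w)) (at t)"
        unfolding has_real_derivative_iff_has_vector_derivative comp_def
        using bounded_linear.has_vector_derivative[OF bounded_linear_Im] by fastforce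
      have "- Im (- \<i> * K ?w) \<le> cmod (K ?w)"
        using complex_Re_le_cmod[of "K ?w"] by simp
      also have "\<dots> \<le> C * (cmod (G ?w))\<^sup>2" using t by (intro KG) simp
      also have "\<dots> \<le> C * (8 * ?p t / (\<mu> * t\<^sup>2))"
        using grad[of ?w] t mu C by (intro mult_left_mono) (auto simp: pos_le_divide_eq mult_ac)
      also have "\<dots> = 8 * C / \<mu> * ?p t / t\<^sup>2" by simp
      finally show "- Im (- \<i> * K ?w) \<le> 8 * C / \<mu> * ?p t / t\<^sup>2" .
    next
      show "(?p \<longlongrightarrow> 0) at_top"
      proof (rule half_plane_Im_vanishing_along_columns[OF cont\<Phi> der\<Phi>])
        show "cmod (K w) \<le> C * M * M" if "Im w < 0" for w
          using KG'[OF that] mult_left_mono[OF bdG[OF that], of "C * M"] C M0 by simp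
        show "\<exists>R. \<forall>z. Im z < 0 \<longrightarrow> R \<le> cmod z \<longrightarrow> cmod (K z) \<le> \<eta>" if "\<eta> > 0" for \<eta>
          by (rule decay'[OF that KG']) (use C M0 in auto)
        have "((\<lambda>x::real. \<mu> / 2 * (Im (F (of_real x)))\<^sup>2) \<longlongrightarrow> \<mu> / 2 * 0\<^sup>2) at_infinity"
          by (intro tendsto_intros lim)
        then show "((\<lambda>x::real. Im (\<Phi> (of_real x))) \<longlongrightarrow> 0) at_infinity"
          by (simp add: bdry)
      qed (use \<Phi>_nonneg in auto)
    qed (use z in auto)
    then show ?thesis by simp
  qed
  then have "\<mu> * (Im z)\<^sup>2 * (cmod (G z))\<^sup>2 \<le> 0" using grad[OF z] by linarith
  then show ?thesis using mu z by (simp add: mult_le_0_iff zero_le_mult_iff)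
qed

section \<open>Absence of solitary waves\<close>

theorem theorem3:
  fixes g c \<delta> :: real
    and \<phi> :: "real \<Rightarrow> real"
    and W W\<^sub>\<alpha> :: "real \<Rightarrow> complex"
    and F :: "complex \<Rightarrow> complex"
  assumes "g > 0"
    and "dyadic_multiplier \<phi>"
    and "\<And>\<alpha>. (W has_vector_derivative W\<^sub>\<alpha> \<alpha>) (at \<alpha>)"
    and "W\<^sub>\<alpha> \<in> besov_half_2_1 \<phi>"
    and "\<delta> > 0"
    and "\<And>\<alpha>. cmod (1 + W\<^sub>\<alpha> \<alpha>) \<ge> \<delta>"
    and "holomorphic_extension W F"
    and "\<And>z. Im z < 0 \<Longrightarrow> 1 + deriv F z \<noteq> 0"
    and "\<And>\<alpha>. complex_of_real (2 * g * Im (W \<alpha>)) =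
           (complex_of_real c)\<^sup>2 *
             ((W\<^sub>\<alpha> \<alpha> + cnj (W\<^sub>\<alpha> \<alpha>) + (complex_of_real (cmod (W\<^sub>\<alpha> \<alpha>)))\<^sup>2)
               / (complex_of_real (cmod (1 + W\<^sub>\<alpha> \<alpha>)))\<^sup>2)"
  shows "\<exists>r::real. \<forall>\<alpha>. W \<alpha> = complex_of_real r"
proof -
  let ?u = "W\<^sub>\<alpha>" and ?y = "\<lambda>x. Im (W x)"
  obtain L where lip: "L-lipschitz_on {z. Im z \<le> 0} F"
    and holF: "F holomorphic_on {z. Im z < 0}"
    and FW: "\<And>x. F (of_real x) = W x"
    using assms(7) by (auto simp: holomorphic_extension_def)
  have contF: "continuous_on {z. Im z \<le> 0} F"
    using lip by (rule lipschitz_on_continuous_on)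
  have u_uc: "uniformly_continuous_on UNIV ?u" and u_lim: "(?u \<longlongrightarrow> 0) at_infinity"
    using besov_half_2_1_vanishing[OF assms(2,4)] by auto
  have bernoulli: "2 * g * ?y x = c\<^sup>2 * (1 - 1 / (cmod (1 + ?u x))\<^sup>2)" for x
  proof -
    have "1 + ?u x \<noteq> 0" using assms(6)[of x] assms(5) by auto
    have "?u x + cnj (?u x) + (complex_of_real (cmod (?u x)))\<^sup>2 = of_real ((cmod (1 + ?u x))\<^sup>2 - 1)"
      unfolding complex_eq_iff of_real_power[symmetric] cmod_power2
      by (simp add: power2_eq_square algebra_simps)
    then have "complex_of_real (2 * g * ?y x) =
        of_real (c\<^sup>2 * (((cmod (1 + ?u x))\<^sup>2 - 1) / (cmod (1 + ?u x))\<^sup>2))"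
      using assms(9)[of x] by simp
    then have "2 * g * ?y x = c\<^sup>2 * (((cmod (1 + ?u x))\<^sup>2 - 1) / (cmod (1 + ?u x))\<^sup>2)"
      by (rule of_real_eq_iff[THEN iffD1])
    then show ?thesis
      using \<open>1 + ?u x \<noteq> 0\<close> by (simp add: diff_divide_distrib)
  qed

  define G where "G z = (if Im z < 0 then deriv F z else ?u (Re z))" for z
  have contG: "continuous_on {z. Im z \<le> 0} G"
    using half_plane_derivative_boundary_values[OF lip holF _ u_uc] assms(3) FW
    unfolding G_def[abs_def] by simp
  have derF: "(F has_field_derivative G z) (at z)" if "Im z < 0" for z
    using holomorphic_derivI[OF holF open_halfspace_Im_lt] that by (simp add: G_def)
  have G_real: "G (of_real x) = ?u x" for x by (simp add: G_def)
  have "deriv F holomorphic_on {z. Im z < 0}"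
    using holF by (rule holomorphic_deriv) (rule open_halfspace_Im_lt)
  then have holG: "G holomorphic_on {z. Im z < 0}"
    by (rule holomorphic_transform) (simp add: G_def)
  obtain M where M: "\<And>z. Im z \<le> 0 \<Longrightarrow> cmod (G z) \<le> M"
  proof -
    obtain U where U: "\<And>x. cmod (?u x) \<le> U"
      using assms(4) by (auto simp: besov_half_2_1_def bounded_iff)
    have "cmod (G z) \<le> U" if "Im z < 0" for z
    proof (rule half_plane_bounded_max_modulus[OF contG holG _ _ that, where M = L])
      show "cmod (G (of_real x)) \<le> U" for x by (simp add: G_real U)
      show "cmod (G w) \<le> L" if w: "Im w < 0" for w
        by (rule Lipschitz_imp_deriv_bound[OF lipschitz_on_subset[OF lip] open_halfspace_Im_lt _ derF[OF w]])
           (use w in auto)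
    qed
    then have "cmod (G z) \<le> U" if "Im z \<le> 0" for z
      using that U by (cases "Im z < 0") (auto simp: G_def)
    then show ?thesis using that by blast
  qed
  have G_decay: "\<exists>R. \<forall>z. Im z \<le> 0 \<longrightarrow> R \<le> cmod z \<longrightarrow> cmod (G z) \<le> e" if "e > 0" for e
    by (rule half_plane_decay[OF contG holG M _ that]) (simp_all add: G_real u_lim)

  have M': "cmod (G z) \<le> M" if "Im z < 0" for z
    using that by (intro M) simp
  have G_decay': "\<exists>R. \<forall>z. Im z < 0 \<longrightarrow> R \<le> cmod z \<longrightarrow> cmod (G z) \<le> e" if "e > 0" for e
    using G_decay[OF that] by (meson less_imp_le)
  have y_lim: "(?y \<longlongrightarrow> 0) at_infinity"
  proof -
    have "((\<lambda>x. c\<^sup>2 / (2 * g) * (1 - 1 / (cmod (1 + ?u x))\<^sup>2)) \<longlongrightarrow> c\<^sup>2 / (2 * g) * (1 - 1 / (cmod (1 + 0))\<^sup>2)) at_infinity"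
      by (intro tendsto_intros u_lim) auto
    moreover have "?y = (\<lambda>x. c\<^sup>2 / (2 * g) * (1 - 1 / (cmod (1 + ?u x))\<^sup>2))"
      using bernoulli assms(1) by (auto simp: field_simps)
    ultimately show ?thesis by simp
  qed

  have "G z = 0" if z: "Im z < 0" for z
  proof (cases "c = 0")
    case True
    then have y0: "?y x = 0" for x
      using bernoulli[of x] assms(1) by simp
    show ?thesis
      by (rule half_plane_square_flux_imp_deriv_zero[where F = F and G = G and \<Phi> = "\<lambda>_. 0" and K = "\<lambda>_. 0"
            and C = 0 and \<mu> = 1 and M = M])
         (use contF derF M' G_decay' y0 z FW in auto)
  next
    case False
    define \<mu> where "\<mu> = 2 * g / c\<^sup>2"
    have mu: "\<mu> > 0" using assms(1) False by (simp add: \<mu>_def)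
    have mu_y: "\<mu> * ?y x = 1 - 1 / (cmod (1 + ?u x))\<^sup>2" for x
      using bernoulli[of x] False by (simp add: \<mu>_def field_simps)
    obtain R where R: "\<And>z. Im z \<le> 0 \<Longrightarrow> R \<le> cmod z \<Longrightarrow> cmod (G z) \<le> 1 / 2"
      using G_decay[of "1/2"] by auto
    have lower: "\<delta> \<le> cmod (1 + G z)" if "Im z \<le> 0" for z
    proof (rule half_plane_min_modulus[where f = "\<lambda>z. 1 + G z" and m = "1 / 2" and R = R])
      show "continuous_on {z. Im z \<le> 0} (\<lambda>z. 1 + G z)"
        by (intro continuous_intros contG)
      show "(\<lambda>z. 1 + G z) holomorphic_on {z. Im z < 0}"
        by (intro holomorphic_intros holG)
      show "1 + G w \<noteq> 0" if "Im w < 0" for w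
        using assms(8)[OF that] that by (simp add: G_def)
      show "1 / 2 \<le> cmod (1 + G w)" if "Im w \<le> 0" "R \<le> cmod w" for w
        using norm_triangle_ineq2[of 1 "- G w"] R[OF that] by simp
    qed (use assms(5,6) that in \<open>auto simp: G_real\<close>)
    have ne: "1 + G z \<noteq> 0" if "Im z \<le> 0" for z
      using lower[OF that] assms(5) by auto
    let ?K = "\<lambda>z. (G z)\<^sup>2 / (1 + G z)"
    have KG: "cmod (?K z) \<le> 1 / \<delta> * (cmod (G z))\<^sup>2" if "Im z \<le> 0" for z
    proof -
      have "(cmod (G z))\<^sup>2 / cmod (1 + G z) \<le> (cmod (G z))\<^sup>2 / \<delta>"
        using lower[OF that] assms(5) by (intro divide_left_mono mult_pos_pos) auto
      then show ?thesis by (simp add: norm_divide norm_power)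
    qed
    obtain \<Psi> where cont\<Psi>: "continuous_on {z. Im z \<le> 0} \<Psi>"
      and der\<Psi>: "\<And>z. Im z < 0 \<Longrightarrow> (\<Psi> has_field_derivative ?K z) (at z)"
      and bdry\<Psi>: "\<And>x. ((\<lambda>x. \<Psi> (of_real x)) has_vector_derivative ?K (of_real x)) (at x)"
    proof (rule half_plane_primitive[where f = ?K and M = "1 / \<delta> * M\<^sup>2"])
      show "continuous_on {z. Im z \<le> 0} ?K"
        using ne by (intro continuous_intros contG) auto
      show "?K holomorphic_on {z. Im z < 0}"
        using ne by (intro holomorphic_intros holG) auto
      show "cmod (?K z) \<le> 1 / \<delta> * M\<^sup>2" if "Im z < 0" for z
        by (rule order_trans[OF KG mult_left_mono[OF power_mono[OF M]]]) (use that assms(5) in auto)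
    qed (rule that)
    have y_der: "(?y has_real_derivative Im (?u x)) (at x)" for x
      unfolding has_real_derivative_iff_has_vector_derivative
      using bounded_linear.has_vector_derivative[OF bounded_linear_Im assms(3)] .
    have flux: "Im (?K (of_real x)) = \<mu> * ?y x * Im (?u x)" for x
    proof -
      have "1 + ?u x \<noteq> 0" using assms(6)[of x] assms(5) by auto
      then have "?K (of_real x) = ?u x - 1 + 1 / (1 + ?u x)"
        by (simp add: G_real field_simps power2_eq_square)
      then have "Im (?K (of_real x)) = Im (?u x - 1 + 1 / (1 + ?u x))"
        by (rule arg_cong)
      also have "\<dots> = Im (?u x) * (1 - 1 / (cmod (1 + ?u x))\<^sup>2)"
        unfolding cmod_power2 by (simp add: Im_divide algebra_simps)
      finally have "Im (?K (of_real x)) = Im (?u x) * (1 - 1 / (cmod (1 + ?u x))\<^sup>2)" .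
      then show ?thesis by (simp add: mu_y)
    qed
    \<comment> \<open>both terms have the derivative \<open>\<mu> y y'\<close>; the constant is then absorbed into the primitive\<close>
    let ?d = "\<lambda>x::real. Im (\<Psi> (of_real x)) - \<mu> / 2 * (?y x)\<^sup>2"
    have "(?d has_real_derivative 0) (at x)" for x
    proof -
      have "((\<lambda>x. Im (\<Psi> (of_real x))) has_real_derivative Im (?K (of_real x))) (at x)"
        unfolding has_real_derivative_iff_has_vector_derivative
        by (rule bounded_linear.has_vector_derivative[OF bounded_linear_Im bdry\<Psi>])
      from DERIV_diff[OF this DERIV_cmult[OF DERIV_power[OF y_der, of 2], of "\<mu> / 2"]]
      show ?thesis by (simp only: flux) simp
    qed
    then have const_d: "?d x = ?d 0" for x
      using DERIV_isconst_all by blast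
    let ?\<Phi> = "\<lambda>z. \<Psi> z - \<i> * of_real (?d 0)"
    show ?thesis
    proof (rule half_plane_square_flux_imp_deriv_zero[where F = F and G = G and \<Phi> = ?\<Phi> and K = ?K
            and C = "1 / \<delta>" and \<mu> = \<mu> and M = M])
      show "continuous_on {z. Im z \<le> 0} ?\<Phi>"
        by (intro continuous_intros cont\<Psi>)
      show "(?\<Phi> has_field_derivative ?K w) (at w)" if "Im w < 0" for w
        using DERIV_diff[OF der\<Psi>[OF that] DERIV_const] by simp
      show "Im (?\<Phi> (of_real x)) = \<mu> / 2 * (Im (F (of_real x)))\<^sup>2" for x
        using const_d[of x] by (simp add: FW)
      show "((\<lambda>x::real. Im (F (of_real x))) \<longlongrightarrow> 0) at_infinity"
        using y_lim by (simp add: FW)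
      show "cmod (?K w) \<le> 1 / \<delta> * (cmod (G w))\<^sup>2" if "Im w < 0" for w
        using that by (intro KG) simp
    qed (use contF derF M' G_decay' mu z assms(5) in auto)
  qed
  then have G0: "G z = 0" if "Im z < 0" for z using that by blast
  have W_eq: "W a = W b" for a b
    using half_plane_mean_value[OF contF derF open_UNIV convex_UNIV, of 0 0 "of_real b" "of_real a"] G0 FW
    by simp
  have "?y = (\<lambda>_. ?y 0)" using W_eq by metis
  then have "?y 0 = 0"
    using y_lim tendsto_unique[OF _ tendsto_const] by (metis trivial_limit_at_infinity)
  then have "W a = of_real (Re (W 0))" for a
    using W_eq[of a 0] by (simp add: complex_eq_iff)
  then show ?thesis by blast
qed

end
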